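(* Let $\{\lambda_n\}_{n\ge1}$ be an admissible scale, let $r,s$ be nonnegative integers, let $\ell>0$, and let $\alpha_1,\dots,\alpha_r>0$ and $\beta_1,\dots,\beta_s>0$ be real numbers. For $v\in\mathbb{R}$ and each $n$ put $$z=e^{2\pi v},\qquad q=e^{-\pi\lambda_n^{-1}},\qquad a_j=q^{\alpha_j}\ (1\le j\le r),\qquad b_k=q^{\beta_k}\ (1\le k\le s),$$ and write $g(w;q)=g(a_1,\dots,a_r;b_1,\dots,b_s;q;\ell;w)$. Then $$g(-q^{-4n\ell}z;q)=\exp\left\{\frac{\pi\lambda_n}{\ell}\left(v+\frac{2n\ell}{\lambda_n}\right)^2\right\}\sqrt{\frac{\lambda_n}{\ell}}\left\{1+\mathcal{O}\left(e^{-\ell^{-1}\pi\lambda_n}\right)\right\}$$ and $$g(q^{-4n\ell}z;q)=\exp\left\{\frac{\pi\lambda_n}{\ell}\left(v+\frac{2n\ell}{\lambda_n}\right)^2-\frac{\pi\lambda_n}{4\ell}\right\}2\sqrt{\frac{\lambda_n}{\ell}}\left\{\cos\frac{\pi\lambda_n v}{\ell}+\mathcal{O}\left(e^{-2\ell^{-1}\pi\lambda_n}\right)\right\}$$ as $n\to\infty$, where the $\mathcal{O}$-terms are uniform for $v$ in any compact subset of $\mathbb{R}$.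
   Context: An admissible scale is a sequence $\{\lambda_n\}_{n=1}^\infty$ of positive numbers with $\lim_{n\to\infty}\lambda_n/\log n=\infty$ and $\lim_{n\to\infty}n/\lambda_n^2=\infty$. For $0<q<1$ and $x\in\mathbb{C}$, $(x;q)_\infty=\prod_{k=0}^\infty(1-xq^k)$, and $(x_1,\dots,x_m;q)_\infty=\prod_{j=1}^m(x_j;q)_\infty$. For nonnegative integers $r,s$, a real $\ell>0$, and $0\le a_1,\dots,a_r,b_1,\dots,b_s<1$, $$g(a_1,\dots,a_r;b_1,\dots,b_s;q;\ell;w)=\sum_{k=0}^\infty\frac{(q^{k+1},b_1q^k,\dots,b_sq^k;q)_\infty\,q^{\ell k^2}(-w)^k}{(a_1q^k,\dots,a_rq^k;q)_\infty}.$$ Note that $q$ (and hence $a_j,b_k$) depends on $n$. Uniformity on compacts means: for each compact $K\subset\mathbb{R}$ there are $C,N$ such that the error term is bounded in absolute value by $C$ times the indicated quantity for all $n\ge N$ and $v\in K$. *)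

theory Defs
  imports "HOL-Analysis.Analysis"
begin

text \<open>Sequences are indexed by \<open>n \<ge> 1\<close>; the value at \<open>0\<close> is unconstrained.\<close>

definition admissible_scale :: "(nat \<Rightarrow> real) \<Rightarrow> bool" where
  "admissible_scale lam \<longleftrightarrow>
     (\<forall>n\<ge>1. lam n > 0) \<and>
     filterlim (\<lambda>n. lam n / ln (real n)) at_top sequentially \<and>
     filterlim (\<lambda>n. real n / (lam n)\<^sup>2) at_top sequentially"

definition qpoch_inf :: "complex \<Rightarrow> real \<Rightarrow> complex" where
  "qpoch_inf x q = (\<Prod>k. 1 - x * of_real (q ^ k))"

text \<open>
  The parameters \<open>a\<^sub>1, \<dots>, a\<^sub>r\<close> and \<open>b\<^sub>1, \<dots>, b\<^sub>s\<close> are given by functions of which only the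
  values on \<open>{1..r}\<close> and \<open>{1..s}\<close> are used.
\<close>

definition g_series ::
  "nat \<Rightarrow> nat \<Rightarrow> (nat \<Rightarrow> real) \<Rightarrow> (nat \<Rightarrow> real) \<Rightarrow> real \<Rightarrow> real \<Rightarrow> complex \<Rightarrow> complex" where
  "g_series r s a b q l w =
     (\<Sum>k. qpoch_inf (of_real (q ^ (k + 1))) q *
           (\<Prod>j=1..s. qpoch_inf (of_real (b j * q ^ k)) q) *
           of_real (q powr (l * real (k\<^sup>2))) * (- w) ^ k /
           (\<Prod>j=1..r. qpoch_inf (of_real (a j * q ^ k)) q))"

definition bigo_unif_on_compacts :: "(nat \<Rightarrow> real \<Rightarrow> complex) \<Rightarrow> (nat \<Rightarrow> real) \<Rightarrow> bool" where
  "bigo_unif_on_compacts E h \<longleftrightarrow>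
     (\<forall>K. compact K \<longrightarrow> (\<exists>C N. \<forall>n\<ge>N. \<forall>v\<in>K. norm (E n v) \<le> C * h n))"

end

theory Submission
  imports Defs "HOL-Probability.Characteristic_Functions"
begin

text \<open>
  Completing the square around \<open>x = v \<lambda>\<^sub>n / l + 2 n\<close> turns \<open>g(\<mp> q\<^sup>-\<^sup>4\<^sup>n\<^sup>l z; q)\<close> into the claimed exponential times
  \<open>\<Sum>k\<ge>0. c\<^sub>k (\<plusminus>1)\<^sup>k exp (- \<pi> t (k - x)\<^sup>2)\<close> with \<open>t = l / \<lambda>\<^sub>n\<close>, where the \<open>q\<close>-Pochhammer factor satisfies
  \<open>exp (- A q\<^sup>k) \<le> c\<^sub>k \<le> exp (A q\<^sup>k)\<close> for some \<open>A = O(\<lambda>\<^sub>n\<^sup>2)\<close>.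
  For \<open>k \<ge> n\<close> the factor \<open>c\<^sub>k\<close> differs from 1 by about \<open>\<lambda>\<^sub>n\<^sup>2 exp (- \<pi> n / \<lambda>\<^sub>n)\<close>, and for \<open>k < n\<close> the
  Gaussian is at most \<open>exp (- c n\<^sup>2 / \<lambda>\<^sub>n)\<close>, which beats \<open>exp A\<close>. Since \<open>n / \<lambda>\<^sub>n\<^sup>2 \<rightarrow> \<infinity>\<close>, both errors are
  negligible, so the sum may be replaced by the theta series over all integers, and Jacobi's
  inversion formula gives the asymptotics. The alternating series reduces to the plain one by
  \<open>\<Sum> (-1)\<^sup>k f(k) = 2 \<Sum> f(2k) - \<Sum> f(k)\<close>.

  The inversion formula holds because both sides are continuous, even and 1-periodic with the same
  cosine coefficients; such functions are equal by Weierstrass approximation in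
  \<open>cos (2 \<pi> x)\<close>.
\<close>

subsection \<open>Gaussian sums over the integers\<close>

text \<open>The factor pi is the normalisation in which the Fourier transform of
  \<open>gauss t\<close> is \<open>gauss (1/t) / sqrt t\<close>, so that inversion stays within one
  family.\<close>

definition gauss :: "real \<Rightarrow> real \<Rightarrow> real" where
  "gauss t y = exp (- (pi * t * y\<^sup>2))"

lemma gauss_pos [simp]: "gauss t y > 0"
  and gauss_nonneg [simp]: "gauss t y \<ge> 0"
  and gauss_minus [simp]: "gauss t (- y) = gauss t y"
  by (simp_all add: gauss_def)

lemma continuous_on_gauss [continuous_intros]:
  "continuous_on A f \<Longrightarrow> continuous_on A (\<lambda>x. gauss t (f x))"
  unfolding gauss_def by (intro continuous_intros)

lemma summable_exp_abs_int:
  assumes "c > 0"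
  shows "(\<lambda>m::int. exp (- (c * real_of_int \<bar>m\<bar>))) summable_on A"
proof -
  let ?f = "\<lambda>m::int. exp (- (c * real_of_int \<bar>m\<bar>))"
  have *: "(\<lambda>n::nat. exp (- (c * real n))) summable_on UNIV"
  proof (rule summable_nonneg_imp_summable_on)
    have "summable (\<lambda>n. exp (- c) ^ n)"
      using assms by (intro summable_geometric) auto
    then show "summable (\<lambda>n::nat. exp (- (c * real n)))"
      by (simp add: exp_of_nat_mult [symmetric] mult.commute)
  qed auto
  have 1: "?f summable_on range int"
    by (subst summable_on_reindex) (use * in \<open>auto simp: o_def\<close>)
  have 2: "?f summable_on range (\<lambda>n. - int n)"
    by (subst summable_on_reindex) (use * in \<open>auto simp: o_def inj_def\<close>)
  have "range int \<union> range (\<lambda>n. - int n) = UNIV"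
    by (auto simp: image_iff) (metis int_cases2)
  with summable_on_union [OF 1 2] have "?f summable_on UNIV"
    by simp
  then show ?thesis
    by (rule summable_on_subset) auto
qed

text \<open>Since y^2 >= |y| - 1/4, the Gaussian has a geometric majorant in |m| that does not
  depend on x in [-B, B]. It serves both for summability and for the Weierstrass M-test.\<close>

lemma gauss_shift_le:
  assumes "t > 0" "\<bar>x\<bar> \<le> B"
  shows "gauss t (real_of_int m + x) \<le> exp (pi * t * (B + 1/4)) * exp (- (pi * t * real_of_int \<bar>m\<bar>))"
proof -
  define y where "y = real_of_int m + x"
  have "\<bar>y\<bar> - 1/4 \<le> y\<^sup>2"
    using zero_le_power2 [of "\<bar>y\<bar> - 1/2"] by (simp add: power2_eq_square algebra_simps flip: abs_mult)
  moreover have "real_of_int \<bar>m\<bar> \<le> \<bar>y\<bar> + B"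
    using assms unfolding y_def by linarith
  ultimately have "pi * t * (real_of_int \<bar>m\<bar> - B - 1/4) \<le> pi * t * y\<^sup>2"
    using assms by (intro mult_left_mono) auto
  then show ?thesis
    unfolding gauss_def y_def [symmetric] by (simp add: algebra_simps flip: exp_add)
qed

lemma gauss_summable:
  assumes "t > 0"
  shows "(\<lambda>m::int. gauss t (real_of_int m + x)) summable_on A"
proof (rule summable_on_comparison_test)
  show "(\<lambda>m::int. exp (pi * t * (\<bar>x\<bar> + 1/4)) * exp (- (pi * t * real_of_int \<bar>m\<bar>))) summable_on A"
    using assms by (intro summable_on_cmult_right summable_exp_abs_int) auto
qed (use gauss_shift_le [OF assms] in auto)

text \<open>From m^2 - J^2 >= |m| - J, each term is at most \<open>gauss s (real J)\<close> times a
  geometric term whose ratio depends only on \<open>s0\<close>. Hence one constant works for all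
  \<open>s \<ge> s0\<close>.\<close>

lemma gauss_tail:
  assumes "s0 > 0"
  obtains K where "K > 0" and
    "\<And>s. s \<ge> s0 \<Longrightarrow> (\<Sum>\<^sub>\<infinity>m\<in>{m. int J \<le> \<bar>m\<bar>}. gauss s (real_of_int m)) \<le> K * gauss s (real J)"
proof
  let ?A = "{m. int J \<le> \<bar>m\<bar>}"
  define K where "K = (\<Sum>\<^sub>\<infinity>m\<in>?A. exp (pi * s0 * real J) * exp (- (pi * s0 * real_of_int \<bar>m\<bar>)))"
  have K: "(\<lambda>m::int. exp (pi * s0 * real J) * exp (- (pi * s0 * real_of_int \<bar>m\<bar>))) summable_on ?A"
    using assms by (intro summable_on_cmult_right summable_exp_abs_int) auto
  have "K \<ge> 0"
    unfolding K_def by (rule infsum_nonneg) auto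
  then show "K + 1 > 0"
    by simp
  fix s assume s: "s \<ge> s0"
  have "gauss s (real_of_int m) \<le> exp (pi * s0 * real J) * exp (- (pi * s0 * real_of_int \<bar>m\<bar>)) * gauss s (real J)"
    if "m \<in> ?A" for m
  proof -
    \<comment> \<open>If |m| > J, the factor |m| + J is at least 1. If |m| = J, both sides vanish;
      this case includes m = J = 0, where |m| + J < 1.\<close>
    have "(\<bar>m\<bar> - int J) * 1 \<le> (\<bar>m\<bar> - int J) * (\<bar>m\<bar> + int J)" 
    proof (cases "\<bar>m\<bar> = int J")
      case False
      with that show ?thesis by (intro mult_left_mono) auto
    qed auto
    also have "\<dots> = m\<^sup>2 - int J ^ 2"
      by (simp add: algebra_simps power2_eq_square flip: abs_mult)
    finally have "real_of_int (\<bar>m\<bar> - int J) \<le> real_of_int (m\<^sup>2 - int J ^ 2)"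
      by (simp only: of_int_le_iff mult_1_right)
    then have "pi * s0 * (real_of_int \<bar>m\<bar> - real J) \<le> pi * s * ((real_of_int m)\<^sup>2 - (real J)\<^sup>2)"
      using s assms that by (intro mult_mono) auto
    then show ?thesis
      by (simp add: gauss_def algebra_simps flip: exp_add)
  qed
  then have "(\<Sum>\<^sub>\<infinity>m\<in>?A. gauss s (real_of_int m)) \<le>
      (\<Sum>\<^sub>\<infinity>m\<in>?A. exp (pi * s0 * real J) * exp (- (pi * s0 * real_of_int \<bar>m\<bar>)) * gauss s (real J))"
    using gauss_summable [of s 0] s assms K by (intro infsum_mono summable_on_cmult_left) auto
  also have "\<dots> = K * gauss s (real J)"
    unfolding K_def by (rule infsum_cmult_left) (use K in auto)
  also have "\<dots> \<le> (K + 1) * gauss s (real J)"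
    by (intro mult_right_mono) auto
  finally show "(\<Sum>\<^sub>\<infinity>m\<in>?A. gauss s (real_of_int m)) \<le> (K + 1) * gauss s (real J)" .
qed

subsection \<open>The Fourier transform of a Gaussian\<close>

text \<open>A rescaling of the characteristic function exp (- u^2 / 2) of the standard normal
  distribution, whose real part is the cosine integral.\<close>

lemma has_bochner_integral_gauss_cos:
  assumes t: "t > 0"
  shows "has_bochner_integral lborel (\<lambda>x. gauss t x * cos (2 * pi * \<xi> * x)) (gauss (1/t) \<xi> / sqrt t)"
proof -
  \<comment> \<open>With this c, the standard normal density at c x is
    \<open>gauss t x / sqrt (2 * pi)\<close>; u is chosen below so that u c = 2 pi \<xi>.\<close>
  define c where "c = sqrt (2 * pi * t)"
  have c: "c > 0" "c\<^sup>2 = 2 * pi * t"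
    using t by (simp_all add: c_def)
  define u where "u = 2 * pi * \<xi> / c"
  have int: "integrable lborel (\<lambda>x. std_normal_density x * cos (u * x))"
    by (rule Bochner_Integration.integrable_bound [where f = std_normal_density])
      (auto simp: abs_mult intro!: mult_left_le)
  interpret real_distribution std_normal_distribution
    by (rule real_dist_normal_dist)
  have iexp: "integrable std_normal_distribution (\<lambda>x. iexp (u * x))"
    by (rule integrable_iexp) auto
  have "exp (- (u\<^sup>2) / 2) = Re (char std_normal_distribution u)"
    by (subst char_std_normal_distribution) simp
  also have "\<dots> = (\<integral>x. Re (iexp (u * x)) \<partial>std_normal_distribution)"
    unfolding char_def by (rule integral_Re [OF iexp, symmetric])
  also have "\<dots> = (\<integral>x. cos (u * x) \<partial>std_normal_distribution)"
    by (simp add: Re_exp)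
  also have "\<dots> = (\<integral>x. std_normal_density x * cos (u * x) \<partial>lborel)"
    by (subst integral_density) (auto simp: normal_density_nonneg)
  finally have "has_bochner_integral lborel (\<lambda>x. std_normal_density x * cos (u * x)) (exp (- (u\<^sup>2) / 2))"
    using int by (simp add: has_bochner_integral_iff)
  then have "has_bochner_integral lborel (\<lambda>x. std_normal_density (0 + c * x) * cos (u * (0 + c * x))) (exp (- (u\<^sup>2) / 2) /\<^sub>R \<bar>c\<bar>)"
    using c by (subst (asm) lborel_has_bochner_integral_real_affine_iff [where c = c and t = 0]) auto
  then have "has_bochner_integral lborel (\<lambda>x. sqrt (2 * pi) * (std_normal_density (0 + c * x) * cos (u * (0 + c * x))))
     (sqrt (2 * pi) * (exp (- (u\<^sup>2) / 2) /\<^sub>R \<bar>c\<bar>))"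
    by (intro has_bochner_integral_mult_right) auto
  also have "(\<lambda>x. sqrt (2 * pi) * (std_normal_density (0 + c * x) * cos (u * (0 + c * x)))) =
     (\<lambda>x. gauss t x * cos (2 * pi * \<xi> * x))"
    using c t by (simp add: fun_eq_iff std_normal_density_def gauss_def u_def power_mult_distrib mult.assoc)
  also have "sqrt (2 * pi) * (exp (- (u\<^sup>2) / 2) /\<^sub>R \<bar>c\<bar>) = gauss (1/t) \<xi> / sqrt t"
  proof -
    have "u\<^sup>2 / 2 = pi * \<xi>\<^sup>2 / t"
      using t by (simp add: u_def c power_divide power_mult_distrib) (simp add: field_simps power2_eq_square)
    then show ?thesis
      using c t by (simp add: gauss_def c_def real_sqrt_mult field_simps)
  qed
  finally show ?thesis .
qed

text \<open>Dominated convergence. The asymmetric interval [-N, N + 1] is the union of the unit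
  intervals [m, m + 1] with |m| <= N, the form in which it arises from partial sums of the theta
  series.\<close>

lemma integral_gauss_cos_tendsto:
  assumes t: "t > 0"
  shows "(\<lambda>N. integral {- real N..real N + 1} (\<lambda>x. gauss t x * cos (2 * pi * \<xi> * x)))
           \<longlonglongrightarrow> gauss (1/t) \<xi> / sqrt t"
proof -
  let ?f = "\<lambda>x. gauss t x * cos (2 * pi * \<xi> * x)"
  let ?A = "\<lambda>N::nat. {- real N..real N + 1}"
  have f: "integrable lborel ?f" "integral\<^sup>L lborel ?f = gauss (1/t) \<xi> / sqrt t"
    using has_bochner_integral_gauss_cos [OF t, of \<xi>] by (auto simp: has_bochner_integral_iff)
  have "(\<lambda>N. integral\<^sup>L lborel (\<lambda>x. indicator (?A N) x *\<^sub>R ?f x)) \<longlonglongrightarrow> integral\<^sup>L lborel ?f"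
  proof (rule integral_dominated_convergence [where w = "\<lambda>x. \<bar>?f x\<bar>"])
    show "AE x in lborel. (\<lambda>N. indicator (?A N) x *\<^sub>R ?f x) \<longlonglongrightarrow> ?f x"
    proof (rule AE_I2)
      fix x :: real
      have "\<forall>\<^sub>F N in sequentially. indicator (?A N) x *\<^sub>R ?f x = ?f x"
        using eventually_ge_at_top [of "nat \<lceil>\<bar>x\<bar>\<rceil>"]
      proof eventually_elim
        case (elim N)
        then have "\<bar>x\<bar> \<le> real N" by linarith
        then show ?case by (auto simp: indicator_def)
      qed
      then show "(\<lambda>N. indicator (?A N) x *\<^sub>R ?f x) \<longlonglongrightarrow> ?f x"
        by (rule tendsto_eventually)
    qed
    show "integrable lborel (\<lambda>x. \<bar>?f x\<bar>)"
      using f by (intro integrable_abs)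
  qed (use f in \<open>auto simp: indicator_def intro!: AE_I2\<close>)
  moreover have "integral\<^sup>L lborel (\<lambda>x. indicator (?A N) x *\<^sub>R ?f x) = integral (?A N) ?f" for N
    using set_borel_integral_eq_integral(2) [OF set_integrable_subset [of lborel UNIV ?f "?A N"]] f
    by (simp add: set_integrable_def set_lebesgue_integral_def)
  ultimately show ?thesis
    using f by simp
qed

subsection \<open>Uniqueness of cosine series\<close>

text \<open>Multiplying by C(x) = cos (2 pi x) shifts frequencies by 1 in both directions, so D is
  orthogonal to all polynomials in C. By symmetry D is itself a continuous function of C, hence a
  uniform limit of such polynomials, and the integral of D^2 vanishes.\<close>

lemma cosine_coefficients_zero_imp_zero:
  fixes D :: "real \<Rightarrow> real"
  assumes cont: "continuous_on {0..1} D"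
    and sym: "\<And>x. x \<in> {0..1} \<Longrightarrow> D (1 - x) = D x"
    and coeff: "\<And>j::nat. integral {0..1} (\<lambda>x. D x * cos (2 * pi * real j * x)) = 0"
    and x: "x \<in> {0..1}"
  shows "D x = 0"
proof -
  \<comment> \<open>Negative frequencies are included because the induction on the power of C passes
    from j to both j + 1 and j - 1.\<close>
  have coeff_int: "integral {0..1} (\<lambda>x. D x * cos (2 * pi * real_of_int j * x)) = 0" for j
  proof (cases "j \<ge> 0")
    case True
    then show ?thesis using coeff [of "nat j"] by simp
  next
    case False
    then have "integral {0..1} (\<lambda>x. D x * cos (- (2 * pi * real_of_int j * x))) = 0"
      using coeff [of "nat (- j)"] by simp
    then show ?thesis by simp
  qed
  define C where "C = (\<lambda>x. cos (2 * pi * x))"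
  have contC: "continuous_on A C" for A
    unfolding C_def by (intro continuous_intros)
  have moments: "integral {0..1} (\<lambda>x. D x * C x ^ n * cos (2 * pi * real_of_int j * x)) = 0" for n j
  proof (induction n arbitrary: j)
    case 0
    then show ?case using coeff_int by simp
  next
    case (Suc n)
    let ?f = "\<lambda>j x. D x * C x ^ n * cos (2 * pi * real_of_int j * x)"
    have "?f j integrable_on {0..1}" for j
      by (intro integrable_continuous_real continuous_intros cont contC)
    then have "integral {0..1} (\<lambda>x. ?f (j + 1) x + ?f (j - 1) x) = 0"
      by (subst Henstock_Kurzweil_Integration.integral_add) (simp_all only: Suc)
    then have "integral {0..1} (\<lambda>x. (?f (j + 1) x + ?f (j - 1) x) / 2) = 0"
      by (subst integral_divide) simp
    also have "(\<lambda>x. (?f (j + 1) x + ?f (j - 1) x) / 2) =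
        (\<lambda>x. D x * C x ^ Suc n * cos (2 * pi * real_of_int j * x))"
      by (simp add: fun_eq_iff C_def algebra_simps cos_add cos_diff add_divide_distrib)
    finally show ?case .
  qed
  \<comment> \<open>On [0, 1/2] the map \<open>arccos u / (2 * pi)\<close> inverts C; on the other
    half the symmetry of D under x to 1 - x gives the same value.\<close>
  define h where "h = (\<lambda>u. D (arccos u / (2 * pi)))"
  have "arccos u \<le> 2 * pi" if "u \<in> {-1..1}" for u
    by (rule order_trans [OF arccos_ubound]) (use that in auto)
  then have conth: "continuous_on {-1..1} h"
    unfolding h_def
    by (intro continuous_on_compose2 [OF cont])
       (auto intro!: continuous_intros simp: arccos_lbound)
  have Dh: "D x = h (C x)" if "x \<in> {0..1}" for x
  proof (cases "x \<le> 1/2")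
    case True
    with that have "arccos (C x) = 2 * pi * x"
      unfolding C_def by (intro arccos_cos) auto
    then show ?thesis by (simp add: h_def)
  next
    case False
    have "C x = C (1 - x)"
      by (simp add: C_def algebra_simps cos_diff)
    also have "arccos \<dots> = 2 * pi * (1 - x)"
      unfolding C_def using False that by (intro arccos_cos) auto
    finally show ?thesis using sym that by (simp add: h_def)
  qed
  obtain B where B: "B > 0" "\<And>x. x \<in> {0..1} \<Longrightarrow> \<bar>D x\<bar> \<le> B"
    using compact_imp_bounded [OF compact_continuous_image [OF cont]]
    unfolding bounded_pos by auto
  \<comment> \<open>For every polynomial p, the integral of D^2 equals that of D (D - p(C)).
    Approximating h within e / B, where B bounds |D|, makes the latter at most e.\<close>
  have "integral {0..1} (\<lambda>x. D x * D x) \<le> 0 + e" if e: "e > 0" for e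
  proof -
    obtain p where p: "real_polynomial_function p" "\<And>u. u \<in> {-1..1} \<Longrightarrow> \<bar>h u - p u\<bar> < e / B"
      using Stone_Weierstrass_real_polynomial_function [OF _ conth, of "e / B"] e B by auto
    from p(1) obtain a n where pa: "p = (\<lambda>x. \<Sum>i\<le>n. a i * x ^ i)"
      unfolding real_polynomial_function_iff_sum by blast
    have contp: "continuous_on {0..1} (\<lambda>x. p (C x))"
      unfolding pa by (intro continuous_intros contC)
    have "integral {0..1} (\<lambda>x. D x * p (C x)) = integral {0..1} (\<lambda>x. \<Sum>i\<le>n. a i * (D x * C x ^ i))"
      by (simp add: pa sum_distrib_left mult_ac)
    also have "\<dots> = (\<Sum>i\<le>n. integral {0..1} (\<lambda>x. a i * (D x * C x ^ i)))"
      by (intro integral_sum integrable_continuous_real continuous_intros cont contC) auto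
    also have "\<dots> = 0"
      using moments [of _ 0] by simp
    finally have "integral {0..1} (\<lambda>x. D x * D x) = integral {0..1} (\<lambda>x. D x * (D x - p (C x)))"
      by (subst right_diff_distrib, subst Henstock_Kurzweil_Integration.integral_diff)
         (auto intro!: integrable_continuous_real continuous_intros cont contp)
    also have "\<dots> \<le> integral {0..1} (\<lambda>x::real. e)"
    proof (rule integral_le)
      show "D x * (D x - p (C x)) \<le> e" if "x \<in> {0..1}" for x
      proof -
        have "D x * (D x - p (C x)) \<le> \<bar>D x\<bar> * \<bar>D x - p (C x)\<bar>"
          by (metis abs_ge_self abs_mult)
        also have "\<dots> \<le> B * (e / B)"
          using B(1) B(2) [OF that] p(2) [of "C x"]
          by (intro mult_mono) (auto simp: C_def Dh [OF that] less_imp_le)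
        finally show ?thesis using B by simp
      qed
    qed (auto intro!: integrable_continuous_real continuous_intros cont contp)
    finally show ?thesis by simp
  qed
  then have "integral {0..1} (\<lambda>x. D x * D x) \<le> 0"
    by (rule field_le_epsilon)
  moreover have "integral {0..1} (\<lambda>x. D x * D x) \<ge> 0"
    by (intro integral_nonneg integrable_continuous_real continuous_intros cont) auto
  ultimately have "integral {0..1} (\<lambda>x. D x * D x) = 0"
    by simp
  then have "\<forall>x\<in>{0..1}. D x * D x = 0"
    by (subst (asm) integral_eq_0_iff) (auto intro!: continuous_intros cont)
  with x show ?thesis by simp
qed

section \<open>Symmetric partial sums, and orthogonality of cosines\<close>

text \<open>Links unordered sums over the integers to sequences of symmetric partial sums, for which
  integrals and uniform limits can be exchanged.\<close>

lemma filterlim_symmetric_int_intervals: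
  "filterlim (\<lambda>N::nat. {- int N..int N}) (finite_subsets_at_top UNIV) sequentially"
  unfolding filterlim_finite_subsets_at_top
proof safe
  fix X :: "int set" assume X: "finite X"
  then obtain B where B: "\<And>m. m \<in> X \<Longrightarrow> \<bar>m\<bar> \<le> B"
    by (metis abs_ge_self bdd_above_finite bdd_above.unfold finite_imageI imageI)
  show "\<forall>\<^sub>F N in sequentially. finite {- int N..int N} \<and> X \<subseteq> {- int N..int N} \<and> {- int N..int N} \<subseteq> UNIV"
    using eventually_ge_at_top [of "nat B"]
  proof eventually_elim
    case (elim N)
    have "m \<in> {- int N..int N}" if "m \<in> X" for m
      using B [OF that] elim by auto
    then show ?case by auto
  qed
qed

lemma uniform_limit_int_sums:
  fixes f :: "int \<Rightarrow> real \<Rightarrow> real"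
  assumes "\<And>m x. x \<in> Y \<Longrightarrow> \<bar>f m x\<bar> \<le> M m" "M summable_on UNIV"
  shows "uniform_limit Y (\<lambda>N x. \<Sum>m\<in>{- int N..int N}. f m x) (\<lambda>x. \<Sum>\<^sub>\<infinity>m. f m x) sequentially"
proof -
  have "uniform_limit Y (\<lambda>X y. \<Sum>m\<in>X. f m y) (\<lambda>y. \<Sum>\<^sub>\<infinity>m. f m y) (finite_subsets_at_top UNIV)"
    by (rule Weierstrass_m_test_general [where M = M]) (use assms in auto)
  then show ?thesis
    by (rule filterlim_compose [OF _ filterlim_symmetric_int_intervals])
qed

lemma uniform_limit_integral_tendsto:
  fixes f :: "nat \<Rightarrow> real \<Rightarrow> real"
  assumes lim: "uniform_limit {a..b} f g sequentially"
    and cont: "\<And>n. continuous_on {a..b} (f n)"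
  shows "(\<lambda>n. integral {a..b} (f n)) \<longlonglongrightarrow> integral {a..b} g"
proof -
  obtain I J where "\<And>n. (f n has_integral I n) {a..b}" "(g has_integral J) {a..b}" "I \<longlonglongrightarrow> J"
    using uniform_limit_integral [OF lim cont] by auto
  moreover from this have "(\<lambda>n. integral {a..b} (f n)) = I" "integral {a..b} g = J"
    by (auto simp: integral_unique)
  ultimately show ?thesis by simp
qed

lemma cos_add_2pi_int: "cos (y + 2 * pi * real_of_int n) = cos y"
  by (simp add: cos_add cos_integer_2pi sin_integer_2pi)

lemma integral_cos_int:
  "integral {0..1} (\<lambda>x. cos (2 * pi * real_of_int m * x)) = (if m = 0 then 1 else 0)"
proof (cases "m = 0")
  case False
  define c where "c = 2 * pi * real_of_int m"
  have c: "c \<noteq> 0" using False by (simp add: c_def)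
  have "((\<lambda>x. cos (c * x)) has_integral (sin (c * 1) / c - sin (c * 0) / c)) {0..1}"
  proof (rule fundamental_theorem_of_calculus)
    show "((\<lambda>x. sin (c * x) / c) has_vector_derivative cos (c * x)) (at x within {0..1})" for x
      unfolding has_real_derivative_iff_has_vector_derivative [symmetric]
      using c by (auto intro!: derivative_eq_intros)
  qed auto
  moreover have "sin c = 0"
    unfolding c_def sin_zero_iff_int2 by (rule exI [of _ "2 * m"]) simp
  ultimately show ?thesis
    using False by (simp add: c_def integral_unique)
qed simp

text \<open>Product-to-sum formula. Keeping the two indicators separate covers m = j = 0, where both
  hold and the value is 1 instead of 1/2.\<close>

lemma integral_cos_cos_int:
  "integral {0..1} (\<lambda>x. cos (2 * pi * real_of_int m * x) * cos (2 * pi * real_of_int j * x)) =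
     ((if m = j then 1 else 0) + (if m = - j then 1 else 0)) / 2"
proof -
  let ?f = "\<lambda>m x. cos (2 * pi * real_of_int m * x)"
  have "integral {0..1} (\<lambda>x. ?f (m - j) x + ?f (m + j) x) =
      integral {0..1} (?f (m - j)) + integral {0..1} (?f (m + j))"
    by (intro Henstock_Kurzweil_Integration.integral_add integrable_continuous_real continuous_intros)
  also have "\<dots> = (if m = j then 1 else 0) + (if m = - j then 1 else 0)"
    by (simp only: integral_cos_int) (simp add: eq_neg_iff_add_eq_0)
  finally have "integral {0..1} (\<lambda>x. (?f (m - j) x + ?f (m + j) x) / 2) =
      ((if m = j then 1 else 0) + (if m = - j then 1 else 0)) / 2"
    by (subst integral_divide) simp
  also have "(\<lambda>x. (?f (m - j) x + ?f (m + j) x) / 2) = (\<lambda>x. ?f m x * ?f j x)"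
    by (simp add: fun_eq_iff algebra_simps cos_add cos_diff)
  finally show ?thesis .
qed

subsection \<open>The inversion formula for the theta function\<close>

definition theta :: "real \<Rightarrow> real \<Rightarrow> real" where
  "theta t x = (\<Sum>\<^sub>\<infinity>m::int. gauss t (real_of_int m + x))"

text \<open>This is Jacobi's theta_3 at argument pi x with nome exp (- pi t). It is the cosine
  series that \<open>theta\<close> acquires under inversion.\<close>

definition theta_cos :: "real \<Rightarrow> real \<Rightarrow> real" where
  "theta_cos t x = (\<Sum>\<^sub>\<infinity>m::int. gauss t (real_of_int m) * cos (2 * pi * real_of_int m * x))"

lemma theta_nonneg [simp]: "theta t x \<ge> 0"
  by (simp add: theta_def infsum_nonneg)

lemma theta_reflect: "theta t (- x) = theta t x"
  unfolding theta_def
proof (rule infsum_reindex_bij_witness [of _ uminus uminus])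
  show "gauss t (real_of_int (- m) + x) = gauss t (real_of_int m + - x)" for m
    by (metis gauss_minus minus_add_distrib minus_minus of_int_minus)
qed auto

lemma theta_add_int: "theta t (x + real_of_int k) = theta t x"
  unfolding theta_def
  by (rule infsum_reindex_bij_witness [of _ "\<lambda>m. m - k" "\<lambda>m. m + k"]) (auto simp: algebra_simps)

lemma theta_cos_reflect: "theta_cos t (- x) = theta_cos t x"
  by (simp add: theta_cos_def)

lemma theta_cos_add_int: "theta_cos t (x + real_of_int k) = theta_cos t x"
proof -
  have "cos (2 * pi * real_of_int m * (x + real_of_int k)) = cos (2 * pi * real_of_int m * x)" for m
    using cos_add_2pi_int [of "2 * pi * real_of_int m * x" "m * k"] by (simp add: algebra_simps)
  then show ?thesis by (simp add: theta_cos_def)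
qed

lemma uniform_limit_theta:
  assumes "t > 0"
  shows "uniform_limit {0..1} (\<lambda>N x. \<Sum>m\<in>{- int N..int N}. gauss t (real_of_int m + x)) (theta t) sequentially"
  unfolding theta_def [abs_def]
proof (rule uniform_limit_int_sums)
  show "\<bar>gauss t (real_of_int m + x)\<bar> \<le> exp (pi * t * (1 + 1/4)) * exp (- (pi * t * real_of_int \<bar>m\<bar>))"
    if "x \<in> {0..1}" for m x
    using gauss_shift_le [OF assms, of x 1 m] that by simp
qed (use assms in \<open>intro summable_on_cmult_right summable_exp_abs_int, auto\<close>)

lemma uniform_limit_theta_cos:
  assumes "t > 0"
  shows "uniform_limit A (\<lambda>N x. \<Sum>m\<in>{- int N..int N}. gauss t (real_of_int m) * cos (2 * pi * real_of_int m * x))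
           (theta_cos t) sequentially"
  unfolding theta_cos_def [abs_def]
proof (rule uniform_limit_int_sums)
  show "\<bar>gauss t (real_of_int m) * cos (2 * pi * real_of_int m * x)\<bar> \<le> gauss t (real_of_int m)" for m x
    by (simp add: abs_mult mult_left_le)
qed (use gauss_summable [OF assms, of 0] in simp)

text \<open>Unfolding: as the cosine is 1-periodic, the translates of the Gaussian integrated over
  [0, 1] tile the line, and the coefficient becomes the Fourier transform of the Gaussian.\<close>

lemma theta_coefficient:
  assumes t: "t > 0"
  shows "integral {0..1} (\<lambda>x. theta t x * cos (2 * pi * real j * x)) = gauss (1/t) (real j) / sqrt t"
proof (rule LIMSEQ_unique)
  let ?c = "\<lambda>x. cos (2 * pi * real j * x)"
  let ?f = "\<lambda>x. gauss t x * ?c x"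
  let ?S = "\<lambda>N x. \<Sum>m\<in>{- int N..int N}. gauss t (real_of_int m + x)"
  show "(\<lambda>N. integral {0..1} (\<lambda>x. ?S N x * ?c x)) \<longlonglongrightarrow> integral {0..1} (\<lambda>x. theta t x * ?c x)"
  proof (rule uniform_limit_integral_tendsto)
    show "uniform_limit {0..1} (\<lambda>N x. ?S N x * ?c x) (\<lambda>x. theta t x * ?c x) sequentially"
    proof (rule uniform_lim_mult [OF uniform_limit_theta [OF t] uniform_limit_const])
      have "continuous_on {0..1} (theta t)"
        by (rule uniform_limit_theorem [OF _ uniform_limit_theta [OF t]])
           (auto intro!: always_eventually continuous_intros)
      then show "bounded (theta t ` {0..1})"
        by (intro compact_imp_bounded compact_continuous_image) auto
      show "bounded (?c ` {0..1})"
        by (intro compact_imp_bounded compact_continuous_image continuous_intros) auto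
    qed
  qed (intro continuous_intros)
  have shift: "integral {0..1} (\<lambda>x. gauss t (real_of_int m + x) * ?c x) =
      integral {real_of_int m..real_of_int m + 1} ?f" for m
  proof -
    have "?c (real_of_int m + x) = ?c x" for x
      using cos_add_2pi_int [of "2 * pi * real j * x" "int j * m"] by (simp add: algebra_simps)
    then have "integral {0..1} (\<lambda>x. gauss t (real_of_int m + x) * ?c x) = integral {0..1} (\<lambda>x. ?f (real_of_int m + x))"
      by simp
    also have "\<dots> = integral {real_of_int m..real_of_int m + 1} ?f"
      using integral_shift_Icc_real [of 0 1 ?f "real_of_int m"] by (simp add: o_def add.commute)
    finally show ?thesis .
  qed
  have int: "?f integrable_on {a..b}" for a b
    by (intro integrable_continuous_real continuous_intros)
  have "integral {0..1} (\<lambda>x. ?S N x * ?c x) = integral {- real N..real N + 1} ?f" for N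
  proof -
    have "integral {0..1} (\<lambda>x. ?S N x * ?c x) = (\<Sum>m\<in>{- int N..int N}. integral {real_of_int m..real_of_int m + 1} ?f)"
      unfolding sum_distrib_right shift [symmetric]
      by (intro integral_sum integrable_continuous_real continuous_intros) auto
    also have "\<dots> = integral {- real N..real N + 1} ?f"
    proof (induction N)
      case (Suc N)
      have "{- int (Suc N)..int (Suc N)} = insert (- int (Suc N)) (insert (int (Suc N)) {- int N..int N})"
        by auto
      then have "(\<Sum>m\<in>{- int (Suc N)..int (Suc N)}. integral {real_of_int m..real_of_int m + 1} ?f) =
          integral {- 1 - real N..- real N} ?f + (integral {- real N..real N + 1} ?f + integral {real N + 1..real N + 2} ?f)"
        using Suc by (simp add: algebra_simps)
      also have "integral {- real N..real N + 1} ?f + integral {real N + 1..real N + 2} ?f =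
          integral {- real N..real N + 2} ?f"
        by (intro Henstock_Kurzweil_Integration.integral_combine int) auto
      also have "integral {- 1 - real N..- real N} ?f + \<dots> = integral {- 1 - real N..real N + 2} ?f"
        by (intro Henstock_Kurzweil_Integration.integral_combine int) auto
      finally show ?case by (simp add: algebra_simps)
    qed auto
    finally show ?thesis .
  qed
  then show "(\<lambda>N. integral {0..1} (\<lambda>x. ?S N x * ?c x)) \<longlonglongrightarrow> gauss (1/t) (real j) / sqrt t"
    using integral_gauss_cos_tendsto [OF t, of "real j"] by simp
qed

text \<open>Termwise integration, justified by uniform convergence, combined with orthogonality of
  the cosines.\<close>

lemma theta_cos_coefficient:
  assumes t: "t > 0"
  shows "integral {0..1} (\<lambda>x. theta_cos t x * cos (2 * pi * real j * x)) = gauss t (real j)"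
proof (rule LIMSEQ_unique)
  let ?c = "\<lambda>j x. cos (2 * pi * real_of_int j * x)"
  let ?S = "\<lambda>N x. \<Sum>m\<in>{- int N..int N}. gauss t (real_of_int m) * ?c m x"
  show "(\<lambda>N. integral {0..1} (\<lambda>x. ?S N x * ?c (int j) x)) \<longlonglongrightarrow> integral {0..1} (\<lambda>x. theta_cos t x * cos (2 * pi * real j * x))"
  proof (rule uniform_limit_integral_tendsto)
    show "uniform_limit {0..1} (\<lambda>N x. ?S N x * ?c (int j) x) (\<lambda>x. theta_cos t x * cos (2 * pi * real j * x)) sequentially"
      unfolding of_int_of_nat_eq
    proof (rule uniform_lim_mult [OF uniform_limit_theta_cos [OF t] uniform_limit_const])
      have "continuous_on {0..1} (theta_cos t)"
        by (rule uniform_limit_theorem [OF _ uniform_limit_theta_cos [OF t]])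
           (auto intro!: always_eventually continuous_intros)
      then show "bounded (theta_cos t ` {0..1})"
        by (intro compact_imp_bounded compact_continuous_image) auto
      show "bounded ((\<lambda>x. cos (2 * pi * real j * x)) ` {0..1})"
        by (intro compact_imp_bounded compact_continuous_image continuous_intros) auto
    qed
  qed (intro continuous_intros)
  \<comment> \<open>Once N >= j, both frequencies j and -j lie in the range of summation and the
    integral no longer depends on N.\<close>
  have "\<forall>\<^sub>F N in sequentially. integral {0..1} (\<lambda>x. ?S N x * ?c (int j) x) = gauss t (real j)"
    using eventually_ge_at_top [of j]
  proof eventually_elim
    case (elim N)
    have "integral {0..1} (\<lambda>x. ?S N x * ?c (int j) x) =
        integral {0..1} (\<lambda>x. \<Sum>m\<in>{- int N..int N}. gauss t (real_of_int m) * (?c m x * ?c (int j) x))"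
      by (simp add: sum_distrib_right mult.assoc)
    also have "\<dots> = (\<Sum>m\<in>{- int N..int N}. integral {0..1} (\<lambda>x. gauss t (real_of_int m) * (?c m x * ?c (int j) x)))"
      by (intro integral_sum integrable_continuous_real continuous_intros) auto
    also have "\<dots> = (\<Sum>m\<in>{- int N..int N}. gauss t (real_of_int m) *
        (((if m = int j then 1 else 0) + (if m = - int j then 1 else 0)) / 2))"
      by (subst integral_mult_right, subst integral_cos_cos_int) (rule refl)
    \<comment> \<open>Two separate halves, at j and at -j, so that j = 0 needs no case distinction:
      there both halves fall on the same term.\<close>
    also have "\<dots> = (\<Sum>m\<in>{- int N..int N}. (if m = int j then gauss t (real_of_int m) / 2 else 0) +
        (if m = - int j then gauss t (real_of_int m) / 2 else 0))"
      by (intro sum.cong) auto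
    also have "\<dots> = gauss t (real j)"
      unfolding sum.distrib using elim by (subst (1 2) sum.delta) auto
    finally show ?case .
  qed
  then show "(\<lambda>N. integral {0..1} (\<lambda>x. ?S N x * ?c (int j) x)) \<longlonglongrightarrow> gauss t (real j)"
    by (rule tendsto_eventually)
qed

text \<open>Both sides have the j-th cosine coefficient
  \<open>gauss (1/t) (real j) / sqrt t\<close>, so they agree on [0, 1]; periodicity carries this to
  every x through \<open>frac x\<close>.\<close>

theorem theta_inversion:
  assumes t: "t > 0"
  shows "theta t x = theta_cos (1/t) x / sqrt t"
proof -
  define D where "D = (\<lambda>x. theta t x - theta_cos (1/t) x / sqrt t)"
  have cont: "continuous_on {0..1} (theta t)" "continuous_on {0..1} (theta_cos (1/t))"
    by (rule uniform_limit_theorem [OF _ uniform_limit_theta] uniform_limit_theorem [OF _ uniform_limit_theta_cos];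
        use t in \<open>auto intro!: always_eventually continuous_intros\<close>)+
  have "D x = 0" if "x \<in> {0..1}" for x
  proof (rule cosine_coefficients_zero_imp_zero [OF _ _ _ that])
    show "continuous_on {0..1} D"
      unfolding D_def by (intro continuous_intros cont) (use t in auto)
    show "D (1 - x) = D x" for x
      using theta_add_int [of t "- x" 1] theta_cos_add_int [of "1/t" "- x" 1]
      by (simp add: D_def theta_reflect theta_cos_reflect)
    show "integral {0..1} (\<lambda>x. D x * cos (2 * pi * real j * x)) = 0" for j
    proof -
      let ?c = "\<lambda>x. cos (2 * pi * real j * x)"
      have "integral {0..1} (\<lambda>x. D x * ?c x) =
          integral {0..1} (\<lambda>x. theta t x * ?c x - theta_cos (1/t) x * ?c x / sqrt t)"
        by (simp add: D_def algebra_simps)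
      also have "\<dots> = integral {0..1} (\<lambda>x. theta t x * ?c x) - integral {0..1} (\<lambda>x. theta_cos (1/t) x * ?c x / sqrt t)"
        by (intro Henstock_Kurzweil_Integration.integral_diff integrable_continuous_real continuous_intros cont)
           (use t in auto)
      also have "\<dots> = 0"
        by (subst integral_divide) (use t in \<open>simp add: theta_coefficient theta_cos_coefficient\<close>)
      finally show ?thesis .
    qed
  qed
  then have "D (frac x) = 0"
    using frac_lt_1 [of x] by (simp add: less_imp_le)
  moreover have "D (frac x + real_of_int \<lfloor>x\<rfloor>) = D (frac x)"
    by (simp only: D_def theta_add_int theta_cos_add_int)
  ultimately show ?thesis
    by (simp add: D_def frac_def)
qed

section \<open>Theta series for small \<open>t\<close>\<close>

text \<open>Cosines are bounded by 1, so the Gaussian tail bounds the truncation error uniformly in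
  x and in \<open>s \<ge> s0\<close>. The truncations used later have J = 1, 2, 3.\<close>

lemma theta_cos_tail:
  assumes "s0 > 0"
  obtains K where "K > 0" and
    "\<And>s x. s \<ge> s0 \<Longrightarrow>
       \<bar>theta_cos s x - (\<Sum>m\<in>{- int J<..<int J}. gauss s (real_of_int m) * cos (2 * pi * real_of_int m * x))\<bar>
         \<le> K * gauss s (real J)"
proof -
  let ?A = "{m. int J \<le> \<bar>m\<bar>}" and ?B = "{- int J<..<int J}"
  obtain K where K: "K > 0"
    "\<And>s. s \<ge> s0 \<Longrightarrow> (\<Sum>\<^sub>\<infinity>m\<in>?A. gauss s (real_of_int m)) \<le> K * gauss s (real J)"
    using gauss_tail [OF assms] by blast
  have "\<bar>theta_cos s x - (\<Sum>m\<in>?B. gauss s (real_of_int m) * cos (2 * pi * real_of_int m * x))\<bar>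
      \<le> K * gauss s (real J)" if s: "s \<ge> s0" for s x
  proof -
    let ?f = "\<lambda>m. gauss s (real_of_int m) * cos (2 * pi * real_of_int m * x)"
    have le: "norm (?f m) \<le> gauss s (real_of_int m)" for m
      by (simp add: abs_mult mult_left_le)
    have gs: "(\<lambda>m. gauss s (real_of_int m)) summable_on X" for X
      using gauss_summable [of s 0] s assms by simp
    have fs: "?f summable_on X" for X
      by (rule abs_summable_summable, rule Infinite_Sum.abs_summable_on_comparison_test' [OF gs le])
    have "?A \<union> ?B = UNIV" by auto
    then have "theta_cos s x = infsum ?f (?A \<union> ?B)"
      by (simp add: theta_cos_def)
    also have "\<dots> = infsum ?f ?A + sum ?f ?B"
      by (subst infsum_Un_disjoint) (auto intro: fs)
    finally have "\<bar>theta_cos s x - sum ?f ?B\<bar> = norm (infsum ?f ?A)"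
      by simp
    also have "\<dots> \<le> (\<Sum>\<^sub>\<infinity>m\<in>?A. gauss s (real_of_int m))"
      by (rule norm_infsum_le [OF has_sum_infsum [OF fs] has_sum_infsum [OF gs] le])
    finally show ?thesis using K(2) [OF s] by simp
  qed
  with K(1) that show ?thesis by blast
qed

text \<open>After inversion with s = 1/t >= 1, truncation at J = 1 leaves only the term m = 0, which
  is 1.\<close>

lemma theta_asymptotics:
  obtains K where "K > 0" and
    "\<And>t x. 0 < t \<Longrightarrow> t \<le> 1 \<Longrightarrow> \<bar>theta t x * sqrt t - 1\<bar> \<le> K * gauss (1/t) 1"
proof -
  obtain K where K: "K > 0" "\<And>s x. s \<ge> 1 \<Longrightarrow>
       \<bar>theta_cos s x - (\<Sum>m\<in>{- int 1<..<int 1}. gauss s (real_of_int m) * cos (2 * pi * real_of_int m * x))\<bar>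
         \<le> K * gauss s (real 1)"
    using theta_cos_tail [of 1 1] by auto
  have *: "{- int 1<..<int 1} = {0}" by auto
  show ?thesis
  proof
    fix t x :: real assume "0 < t" "t \<le> 1"
    then show "\<bar>theta t x * sqrt t - 1\<bar> \<le> K * gauss (1/t) 1"
      using K(2) [of "1/t" x] unfolding * by (simp add: theta_inversion gauss_def)
  qed fact
qed

definition alt_theta :: "real \<Rightarrow> real \<Rightarrow> real" where
  "alt_theta t x = (\<Sum>\<^sub>\<infinity>m::int. (if even m then 1 else - 1) * gauss t (real_of_int m + x))"

text \<open>Twice the even terms minus all terms; the even ones rescale by
  \<open>gauss t (2 * m + x) = gauss (4 * t) (m + x / 2)\<close>.\<close>

lemma alt_theta_eq:
  assumes t: "t > 0"
  shows "alt_theta t x = 2 * theta (4 * t) (x / 2) - theta t x"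
proof -
  let ?g = "\<lambda>m::int. gauss t (real_of_int m + x)"
  have gs: "?g summable_on X" for X
    using t by (rule gauss_summable)
  have "alt_theta t x = (\<Sum>\<^sub>\<infinity>m. (if even m then 2 * ?g m else 0) + - ?g m)"
    unfolding alt_theta_def by (intro infsum_cong) auto
  also have "\<dots> = (\<Sum>\<^sub>\<infinity>m. if even m then 2 * ?g m else 0) + (\<Sum>\<^sub>\<infinity>m. - ?g m)"
  proof (rule infsum_add)
    have "(\<lambda>m. 2 * ?g m) summable_on {m. even m}"
      by (intro summable_on_cmult_right gs)
    then show "(\<lambda>m. if even m then 2 * ?g m else 0) summable_on UNIV"
      by (rule summable_on_cong_neutral [THEN iffD1, rotated -1]) auto
    show "(\<lambda>m. - ?g m) summable_on UNIV"
      by (simp add: summable_on_uminus gs)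
  qed
  also have "(\<Sum>\<^sub>\<infinity>m. if even m then 2 * ?g m else 0) = (\<Sum>\<^sub>\<infinity>m\<in>range ((*) 2). 2 * ?g m)"
    by (rule infsum_cong_neutral) (auto elim: evenE)
  also have "\<dots> = (\<Sum>\<^sub>\<infinity>m. 2 * ?g (2 * m))"
    by (subst infsum_reindex) (auto simp: o_def inj_def)
  also have "\<dots> = 2 * (\<Sum>\<^sub>\<infinity>m::int. gauss (4 * t) (real_of_int m + x / 2))"
    by (subst infsum_cmult_right' [symmetric], intro infsum_cong)
       (simp add: gauss_def power2_eq_square algebra_simps)
  finally show ?thesis
    by (simp add: theta_def infsum_uminus)
qed

text \<open>With s = 1 / (4 t), inversion gives
  \<open>theta_cos s (x / 2) - theta_cos (4 * s) x\<close>. The constants 1 cancel, and so do the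
  cos (2 pi x) terms, because \<open>gauss s 2 = gauss (4 * s) 1\<close>. What survives is the term
  of frequency 1/2, with an error of order \<open>gauss s 3\<close>.\<close>

lemma alt_theta_asymptotics:
  obtains K where "K > 0" and
    "\<And>t x. 0 < t \<Longrightarrow> t \<le> 1 \<Longrightarrow>
       \<bar>alt_theta t x * sqrt t - 2 * gauss (1/t) (1/2) * cos (pi * x)\<bar> \<le> K * gauss (1/t) (3/2)"
proof -
  obtain K1 where K1: "K1 > 0" "\<And>s x. s \<ge> 1/4 \<Longrightarrow>
       \<bar>theta_cos s x - (\<Sum>m\<in>{- int 3<..<int 3}. gauss s (real_of_int m) * cos (2 * pi * real_of_int m * x))\<bar>
         \<le> K1 * gauss s (real 3)"
    using theta_cos_tail [of "1/4" 3] by auto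
  obtain K2 where K2: "K2 > 0" "\<And>s x. s \<ge> 1 \<Longrightarrow>
       \<bar>theta_cos s x - (\<Sum>m\<in>{- int 2<..<int 2}. gauss s (real_of_int m) * cos (2 * pi * real_of_int m * x))\<bar>
         \<le> K2 * gauss s (real 2)"
    using theta_cos_tail [of 1 2] by auto
  have sets: "{- int 3<..<int 3} = {-2,-1,0,1,2}" "{- int 2<..<int 2} = {-1,0,1}"
    by auto
  show ?thesis
  proof
    show "K1 + K2 > 0" using K1 K2 by simp
    fix t x :: real assume t: "0 < t" "t \<le> 1"
    define s where "s = 1 / (4 * t)"
    have s: "s \<ge> 1/4" "4 * s \<ge> 1" "1 / t = 4 * s" "1 / (4 * t) = s"
      using t by (auto simp: s_def field_simps)
    have g: "gauss (4 * s) 1 = gauss s 2" "gauss (4 * s) (1/2) = gauss s 1" "gauss (4 * s) (3/2) = gauss s 3"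
      by (simp_all add: gauss_def power2_eq_square)
    \<comment> \<open>The left side is \<open>gauss s 4\<close>, so the error of the second
      truncation is absorbed by that of the first.\<close>
    have "gauss (4 * s) 2 \<le> gauss s 3"
      using s by (simp add: gauss_def)
    then have g2: "K2 * gauss (4 * s) 2 \<le> K2 * gauss s 3"
      using K2 by (intro mult_left_mono) auto
    have "theta (4 * t) (x / 2) = theta_cos s (x / 2) / (2 * sqrt t)"
      using t theta_inversion [of "4 * t" "x / 2"] s by (simp add: real_sqrt_mult)
    moreover have "theta t x = theta_cos (4 * s) x / sqrt t"
      using t theta_inversion [of t x] s by simp
    ultimately have "alt_theta t x * sqrt t = theta_cos s (x / 2) - theta_cos (4 * s) x"
      using t by (simp add: alt_theta_eq field_simps)
    moreover have "\<bar>theta_cos s (x / 2) - (1 + 2 * gauss s 1 * cos (pi * x) + 2 * gauss s 2 * cos (2 * pi * x))\<bar> \<le> K1 * gauss s 3"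
      using K1(2) [of s "x / 2"] s unfolding sets by (simp add: gauss_def algebra_simps)
    moreover have "\<bar>theta_cos (4 * s) x - (1 + 2 * gauss s 2 * cos (2 * pi * x))\<bar> \<le> K2 * gauss (4 * s) 2"
      using K2(2) [of "4 * s" x] s unfolding sets by (simp add: g) (simp add: gauss_def algebra_simps)
    ultimately show "\<bar>alt_theta t x * sqrt t - 2 * gauss (1/t) (1/2) * cos (pi * x)\<bar> \<le> (K1 + K2) * gauss (1/t) (3/2)"
      using g2 unfolding s g distrib_right by linarith
  qed
qed

text \<open>A crude bound, uniform in x, for the theta values that multiply the perturbation
  errors.\<close>

lemma theta_upper_bound:
  obtains K where "K > 0" and "\<And>t x. 0 < t \<Longrightarrow> t \<le> 1 \<Longrightarrow> theta t x \<le> K / sqrt t"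
proof -
  obtain K where K: "K > 0"
    "\<And>t x. 0 < t \<Longrightarrow> t \<le> 1 \<Longrightarrow> \<bar>theta t x * sqrt t - 1\<bar> \<le> K * gauss (1/t) 1"
    using theta_asymptotics by blast
  show ?thesis
  proof
    show "K + 1 > 0" using K by simp
    fix t x :: real assume t: "0 < t" "t \<le> 1"
    have "K * gauss (1/t) 1 \<le> K * 1"
      using K t by (intro mult_left_mono) (auto simp: gauss_def)
    then have "theta t x * sqrt t \<le> K + 1"
      using K(2) [OF t, of x] by linarith
    then show "theta t x \<le> (K + 1) / sqrt t"
      using t by (simp add: field_simps)
  qed
qed

subsection \<open>The $q$-Pochhammer factors\<close>

text \<open>Each factor satisfies 1 / (1 - y q^i) <= 1 + y q^i / (1 - y) <= exp (y q^i / (1 - y));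
  multiplying over i sums a geometric series in the exponent.\<close>

lemma qpoch_inf_bounds:
  assumes q: "0 < q" "q < 1" and y: "0 \<le> y" "y < 1"
  obtains Q where "qpoch_inf (of_real y) q = of_real Q"
    and "exp (- (y / ((1 - q) * (1 - y)))) \<le> Q" and "Q \<le> 1"
proof
  let ?f = "\<lambda>i. 1 - y * q ^ i"
  have yq: "0 \<le> y * q ^ i" "y * q ^ i \<le> y" for i
    using q y by (auto simp: mult_left_le power_le_one)
  have pos: "?f i > 0" for i
    using yq(2) [of i] y by simp
  have "summable (\<lambda>i. y * q ^ i)"
    using q by (intro summable_mult summable_geometric) auto
  then have "abs_convergent_prod ?f"
    using yq by (intro summable_imp_abs_convergent_prod) simp
  then have conv: "convergent_prod ?f"
    by (rule abs_convergent_prod_imp_convergent_prod)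
  then have "?f has_prod prodinf ?f"
    by auto
  \<comment> \<open>\<open>qpoch_inf\<close> is a complex product, so the limit of the real product
    is transferred to it.\<close>
  then have "(\<lambda>i. complex_of_real (?f i)) has_prod of_real (prodinf ?f)"
    by (subst has_prod_of_real_iff)
  then show "qpoch_inf (of_real y) q = of_real (prodinf ?f)"
    unfolding qpoch_inf_def by (simp add: has_prod_iff)
  have lim: "(\<lambda>N. \<Prod>i\<le>N. ?f i) \<longlonglongrightarrow> prodinf ?f"
    using conv by (rule convergent_prod_LIMSEQ)
  show "prodinf ?f \<le> 1"
  proof (rule LIMSEQ_le_const2 [OF lim], intro exI allI impI)
    show "(\<Prod>i\<le>N. ?f i) \<le> 1" for N
      using pos yq(1) by (intro prod_le_1) (auto intro: less_imp_le)
  qed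
  have factor: "exp (- (y * q ^ i / (1 - y))) \<le> ?f i" for i
  proof -
    have "1 / ?f i = 1 + y * q ^ i / ?f i"
      using pos [of i] by (simp add: field_simps)
    also have "\<dots> \<le> 1 + y * q ^ i / (1 - y)"
      using yq [of i] y by (intro add_left_mono divide_left_mono mult_pos_pos) auto
    also have "\<dots> \<le> exp (y * q ^ i / (1 - y))"
      by (rule exp_ge_add_one_self)
    finally show ?thesis
      using pos [of i] by (simp add: exp_minus field_simps)
  qed
  show "exp (- (y / ((1 - q) * (1 - y)))) \<le> prodinf ?f"
  proof (rule LIMSEQ_le_const [OF lim], intro exI allI impI)
    fix N
    have "(\<Sum>i\<le>N. q ^ i) \<le> 1 / (1 - q)"
      using sum_le_suminf [OF summable_geometric, of q "{..N}"] q by (simp add: suminf_geometric)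
    then have "y / (1 - y) * (\<Sum>i\<le>N. q ^ i) \<le> y / (1 - y) * (1 / (1 - q))"
      using y by (intro mult_left_mono) auto
    then have "exp (- (y / ((1 - q) * (1 - y)))) \<le> exp (\<Sum>i\<le>N. - (y * q ^ i / (1 - y)))"
      by (simp add: sum_negf sum_distrib_left sum_divide_distrib mult_ac)
    also have "\<dots> = (\<Prod>i\<le>N. exp (- (y * q ^ i / (1 - y))))"
      by (simp add: exp_sum)
    also have "\<dots> \<le> (\<Prod>i\<le>N. ?f i)"
      using factor by (intro prod_mono) auto
    finally show "exp (- (y / ((1 - q) * (1 - y)))) \<le> (\<Prod>i\<le>N. ?f i)" .
  qed
qed

text \<open>Follows from exp u >= 1 + u. It makes 1 / (1 - q) and 1 / (1 - q^\<gamma>) of order L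
  when q = exp (- pi / L).\<close>

lemma inverse_one_minus_exp_le:
  fixes u :: real
  assumes "u > 0"
  shows "1 / (1 - exp (- u)) \<le> 1 + 1 / u"
proof -
  have "exp (- u) \<le> 1 / (1 + u)"
    using exp_ge_add_one_self [of u] assms by (simp add: exp_minus field_simps)
  then have "u / (1 + u) \<le> 1 - exp (- u)"
    using assms by (simp add: field_simps)
  then have "1 / (1 - exp (- u)) \<le> 1 / (u / (1 + u))"
    using assms by (intro divide_left_mono) auto
  also have "\<dots> = 1 + 1 / u"
    using assms by (simp add: field_simps)
  finally show ?thesis .
qed

text \<open>The power L^2 comes from the two factors 1 / (1 - q) and 1 / (1 - q^\<gamma>), each of
  order L; the constant is independent of k and L.\<close>

lemma qpoch_inf_scale_bounds:
  assumes "\<gamma> > 0" and L: "L \<ge> 1" and q: "q = exp (- (pi / L))"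
  obtains Q where "qpoch_inf (of_real (q powr \<gamma> * q ^ k)) q = of_real Q"
    and "exp (- ((1 + 1 / pi) * (1 + 1 / (pi * \<gamma>)) * L\<^sup>2 * q ^ k)) \<le> Q" and "Q \<le> 1"
proof -
  have q01: "0 < q" "q < 1" using L by (auto simp: q)
  have a: "0 < q powr \<gamma>" "q powr \<gamma> < 1"
    using assms by (auto simp: powr_def)
  have qk: "0 < q ^ k" "q ^ k \<le> 1"
    using q01 by (auto intro: power_le_one)
  define y where "y = q powr \<gamma> * q ^ k"
  \<comment> \<open>The bound by \<open>q powr \<gamma>\<close> keeps 1 - y away from 0 uniformly in
    k; the bound by \<open>q ^ k\<close> supplies the decay in k.\<close>
  have y: "0 \<le> y" "y \<le> q powr \<gamma>" "y \<le> q ^ k"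
    using a qk unfolding y_def by (auto simp: mult_left_le mult_left_le_one_le)
  have bound: "1 / (1 - exp (- (c / L))) \<le> (1 + 1 / c) * L" if "c > 0" for c
  proof -
    have "1 / (1 - exp (- (c / L))) \<le> 1 + 1 / (c / L)"
      using that L by (intro inverse_one_minus_exp_le) auto
    also have "\<dots> \<le> L + 1 / (c / L)"
      using L by simp
    finally show ?thesis by (simp add: algebra_simps)
  qed
  have "y / (1 - y) \<le> q ^ k / (1 - q powr \<gamma>)"
    using y a qk by (intro frac_le) auto
  also have "\<dots> = q ^ k * (1 / (1 - exp (- (pi * \<gamma> / L))))"
    by (simp add: q powr_def)
  also have "\<dots> \<le> q ^ k * ((1 + 1 / (pi * \<gamma>)) * L)"
    using bound [of "pi * \<gamma>"] assms qk by (intro mult_left_mono) auto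
  finally have "1 / (1 - q) * (y / (1 - y)) \<le> (1 + 1 / pi) * L * (q ^ k * ((1 + 1 / (pi * \<gamma>)) * L))"
    using bound [of pi] L y a unfolding q by (intro mult_mono) auto
  then have *: "exp (- ((1 + 1 / pi) * (1 + 1 / (pi * \<gamma>)) * L\<^sup>2 * q ^ k)) \<le> exp (- (y / ((1 - q) * (1 - y))))"
    by (simp add: power2_eq_square mult_ac)
  obtain Q where "qpoch_inf (of_real y) q = of_real Q"
    "exp (- (y / ((1 - q) * (1 - y)))) \<le> Q" "Q \<le> 1"
    using qpoch_inf_bounds [OF q01 y(1)] y a by auto
  with * show ?thesis
    using that unfolding y_def by (meson order_trans)
qed

lemma qpoch_inf_prod_bounds:
  assumes "\<And>j. j \<in> J \<Longrightarrow> \<gamma> j > 0" and L: "L \<ge> 1" and q: "q = exp (- (pi / L))"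
  obtains Q where "(\<Prod>j\<in>J. qpoch_inf (of_real (q powr \<gamma> j * q ^ k)) q) = of_real Q"
    and "exp (- ((\<Sum>j\<in>J. (1 + 1 / pi) * (1 + 1 / (pi * \<gamma> j))) * L\<^sup>2 * q ^ k)) \<le> Q" and "Q \<le> 1"
proof -
  let ?B = "\<lambda>j. (1 + 1 / pi) * (1 + 1 / (pi * \<gamma> j))"
  have "\<forall>j\<in>J. \<exists>Q. qpoch_inf (of_real (q powr \<gamma> j * q ^ k)) q = of_real Q \<and>
      exp (- (?B j * L\<^sup>2 * q ^ k)) \<le> Q \<and> Q \<le> 1"
    using qpoch_inf_scale_bounds [OF assms(1) L q] by metis
  then obtain Q where Q: "\<And>j. j \<in> J \<Longrightarrow> qpoch_inf (of_real (q powr \<gamma> j * q ^ k)) q = of_real (Q j)"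
      "\<And>j. j \<in> J \<Longrightarrow> exp (- (?B j * L\<^sup>2 * q ^ k)) \<le> Q j" "\<And>j. j \<in> J \<Longrightarrow> Q j \<le> 1"
    by metis
  show ?thesis
  proof
    show "(\<Prod>j\<in>J. qpoch_inf (of_real (q powr \<gamma> j * q ^ k)) q) = of_real (\<Prod>j\<in>J. Q j)"
      using Q by simp
    have "exp (- ((\<Sum>j\<in>J. ?B j) * L\<^sup>2 * q ^ k)) = (\<Prod>j\<in>J. exp (- (?B j * L\<^sup>2 * q ^ k)))"
    \<comment> \<open>For infinite J the sum defaults to 0 and the product to 1, so both sides are
      1.\<close>
    proof (cases "finite J")
      case True
      then show ?thesis
        by (simp add: exp_sum [symmetric] sum_negf sum_distrib_right mult.assoc)
    qed auto
    also have "\<dots> \<le> (\<Prod>j\<in>J. Q j)"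
      using Q by (intro prod_mono) auto
    finally show "exp (- ((\<Sum>j\<in>J. ?B j) * L\<^sup>2 * q ^ k)) \<le> (\<Prod>j\<in>J. Q j)" .
    show "(\<Prod>j\<in>J. Q j) \<le> 1"
      using Q by (intro prod_le_1) (auto intro: order_trans [OF exp_ge_zero])
  qed
qed

subsection \<open>Perturbed Gaussian sums\<close>

text \<open>The sum is split at n. For m >= n the coefficient is within A q^n exp (A q^n) of 1. For
  m < n the distance to the centre x is at least d; half of the Gaussian exponent gives the small
  factor \<open>gauss (t / 2) d\<close> and the other half keeps the sum convergent.\<close>

lemma theta_perturbation:
  fixes c :: "nat \<Rightarrow> real" and \<epsilon> :: "int \<Rightarrow> real"
  assumes t: "t > 0" and q: "0 < q" "q < 1" and A: "A \<ge> 0"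
    and c: "\<And>k. exp (- (A * q ^ k)) \<le> c k" "\<And>k. c k \<le> exp (A * q ^ k)"
    and \<epsilon>: "\<And>m. \<bar>\<epsilon> m\<bar> \<le> 1"
    and d: "0 \<le> d" "real n + d \<le> x"
  obtains S where "(\<lambda>k. c k * (\<epsilon> (int k) * gauss t (real k - x))) sums S"
    and "\<bar>S - (\<Sum>\<^sub>\<infinity>m::int. \<epsilon> m * gauss t (real_of_int m - x))\<bar> \<le>
           A * q ^ n * exp (A * q ^ n) * theta t x + exp A * gauss (t / 2) d * theta (t / 2) x"
proof -
  define g where "g = (\<lambda>m::int. gauss t (real_of_int m - x))"
  define h where "h = (\<lambda>m::int. gauss (t / 2) (real_of_int m - x))"
  \<comment> \<open>Extending c by zero turns the one-sided series into a sum over all integers; at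
    negative m the defect |C m - 1| is 1, which is at most exp A.\<close>
  define C where "C = (\<lambda>m. if m < 0 then 0 else c (nat m))"
  have g: "(g has_sum theta t x) UNIV"
    using gauss_summable [OF t, of "- x"] theta_reflect [of t x]
    by (simp add: g_def has_sum_iff theta_def)
  have h: "(h has_sum theta (t / 2) x) UNIV"
    using gauss_summable [of "t / 2" "- x"] t theta_reflect [of "t / 2" x]
    by (simp add: h_def has_sum_iff theta_def)
  define a where "a = A * q ^ n * exp (A * q ^ n)"
  define b where "b = exp A * gauss (t / 2) d"
  have ab: "a \<ge> 0" "b \<ge> 0"
    using A q by (auto simp: a_def b_def)
  have gpos: "g m \<ge> 0" "h m \<ge> 0" for m by (simp_all add: g_def h_def)
  have diff: "norm ((C m - 1) * (\<epsilon> m * g m)) \<le> a * g m + b * h m" for m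
  proof -
    have "norm ((C m - 1) * (\<epsilon> m * g m)) = \<bar>C m - 1\<bar> * (\<bar>\<epsilon> m\<bar> * g m)"
      using gpos by (simp add: abs_mult)
    also have "\<dots> \<le> \<bar>C m - 1\<bar> * g m"
      using \<epsilon> [of m] gpos [of m] by (intro mult_left_mono mult_left_le_one_le) auto
    also have "\<dots> \<le> a * g m + b * h m"
    proof (cases "m \<ge> int n")
      case True
      then obtain k where k: "m = int k" "k \<ge> n"
        by (metis nat_0_le of_nat_0_le_iff of_nat_le_iff order_trans)
      define u where "u = A * q ^ k"
      have u: "0 \<le> u" "u \<le> A * q ^ n"
        using A q k by (auto simp: u_def intro!: mult_left_mono power_decreasing)
      have "exp (- u) \<le> c k" "c k \<le> exp u"
        using c unfolding u_def by auto
      moreover have "1 - u \<le> exp (- u)"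
        using exp_ge_add_one_self [of "- u"] by simp
      moreover have "exp u - 1 \<le> u * exp u"
      proof -
        have "(1 - u) * exp u \<le> exp (- u) * exp u"
          using \<open>1 - u \<le> exp (- u)\<close> by (intro mult_right_mono) auto
        then show ?thesis by (simp add: algebra_simps flip: exp_add)
      qed
      moreover have "u \<le> u * exp u"
        using u mult_left_mono [of 1 "exp u" u] by simp
      ultimately have "\<bar>c k - 1\<bar> \<le> u * exp u"
        by linarith
      also have "\<dots> \<le> a"
        unfolding a_def using u by (intro mult_mono) auto
      finally have "\<bar>C m - 1\<bar> * g m \<le> a * g m"
        using k gpos by (intro mult_right_mono) (auto simp: C_def)
      then show ?thesis
        using ab gpos [of m] by (simp add: add_increasing2)
    next
      case False
      have "\<bar>C m - 1\<bar> \<le> exp A"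
      proof (cases "m < 0")
        case True
        then show ?thesis using A by (simp add: C_def)
      next
        case False
        have "A * q ^ nat m \<le> A * 1"
          using A q by (intro mult_left_mono power_le_one) auto
        then have "exp (A * q ^ nat m) \<le> exp A"
          by simp
        with c(2) [of "nat m"] have "c (nat m) \<le> exp A"
          by (rule order_trans)
        moreover have "0 \<le> c (nat m)"
          using c(1) [of "nat m"] by (rule order_trans [OF exp_ge_zero])
        moreover have "1 \<le> exp A"
          using A by simp
        ultimately have "\<bar>c (nat m) - 1\<bar> \<le> exp A"
          by linarith
        then show ?thesis
          using False by (simp add: C_def)
      qed
      moreover have "g m \<le> gauss (t / 2) d * h m"
      proof -
        have "d \<le> x - real_of_int m"
          using False d by linarith
        then have "d\<^sup>2 \<le> (real_of_int m - x)\<^sup>2"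
          using d by (subst power2_commute, intro power_mono) auto
        then have "pi * (t / 2) * d\<^sup>2 \<le> pi * (t / 2) * (real_of_int m - x)\<^sup>2"
          using t by (intro mult_left_mono) auto
        moreover have "pi * t * (real_of_int m - x)\<^sup>2 = 2 * (pi * (t / 2) * (real_of_int m - x)\<^sup>2)"
          by simp
        ultimately show ?thesis
          unfolding g_def h_def gauss_def exp_add [symmetric] exp_le_cancel_iff by linarith
      qed
      ultimately have "\<bar>C m - 1\<bar> * g m \<le> exp A * (gauss (t / 2) d * h m)"
        using gpos by (intro mult_mono) auto
      also have "\<dots> \<le> a * g m + b * h m"
        using ab gpos [of m] by (simp add: b_def mult.assoc add_increasing)
      finally show ?thesis .
    qed
    finally show ?thesis .
  qed
  have bound: "((\<lambda>m. a * g m + b * h m) has_sum (a * theta t x + b * theta (t / 2) x)) UNIV"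
    by (intro has_sum_add has_sum_cmult_right g h)
  have "(\<lambda>m. (C m - 1) * (\<epsilon> m * g m)) summable_on UNIV"
    by (rule abs_summable_summable, rule Infinite_Sum.abs_summable_on_comparison_test' [OF has_sum_imp_summable [OF bound] diff])
  then obtain R where R: "((\<lambda>m. (C m - 1) * (\<epsilon> m * g m)) has_sum R) UNIV"
    by (auto simp: summable_on_def)
  have "(\<lambda>m. \<epsilon> m * g m) summable_on UNIV"
  proof (rule abs_summable_summable, rule Infinite_Sum.abs_summable_on_comparison_test' [OF has_sum_imp_summable [OF g]])
    show "norm (\<epsilon> m * g m) \<le> g m" for m
      using \<epsilon> [of m] gpos [of m] by (simp add: abs_mult mult_left_le_one_le)
  qed
  then have T: "((\<lambda>m. \<epsilon> m * g m) has_sum (\<Sum>\<^sub>\<infinity>m. \<epsilon> m * g m)) UNIV"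
    by simp
  define S where "S = R + (\<Sum>\<^sub>\<infinity>m. \<epsilon> m * g m)"
  have "((\<lambda>m. C m * (\<epsilon> m * g m)) has_sum S) UNIV"
    using has_sum_add [OF R T] by (simp add: S_def algebra_simps)
  \<comment> \<open>Negative indices drop out since C vanishes there, which returns to the series
    over the naturals.\<close>
  then have "((\<lambda>m. C m * (\<epsilon> m * g m)) has_sum S) (range int)"
    by (rule has_sum_cong_neutral [THEN iffD1, rotated -1]) (auto simp: C_def not_less dest: zero_le_imp_eq_int)
  then have "((\<lambda>k. c k * (\<epsilon> (int k) * gauss t (real k - x))) has_sum S) UNIV"
    by (subst (asm) has_sum_reindex) (auto simp: o_def C_def g_def)
  then have "(\<lambda>k. c k * (\<epsilon> (int k) * gauss t (real k - x))) sums S"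
    by (rule has_sum_imp_sums)
  moreover have "norm R \<le> a * theta t x + b * theta (t / 2) x"
    using norm_infsum_le [OF R bound diff] by simp
  ultimately show ?thesis
    using that unfolding S_def g_def a_def b_def by simp
qed

text \<open>K and M depend only on l, V and B, which yields uniformity in v. One bound serves both
  sign patterns, so it is stated at the finer scale \<open>gauss (L / l) (3/2)\<close>, the error of
  the alternating series.\<close>

lemma scaled_perturbation_bound:
  fixes l V B :: real
  assumes l: "l > 0" and B: "B \<ge> 0"
  obtains K M where "\<And>L v n c \<epsilon>. L \<ge> 1 \<Longrightarrow> L \<ge> l \<Longrightarrow> real n \<ge> M * L\<^sup>2 \<Longrightarrow> \<bar>v\<bar> \<le> V \<Longrightarrow>
    (\<And>k. exp (- (B * L\<^sup>2 * exp (- (pi / L)) ^ k)) \<le> c k) \<Longrightarrow>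
    (\<And>k. c k \<le> exp (B * L\<^sup>2 * exp (- (pi / L)) ^ k)) \<Longrightarrow>
    (\<And>m. \<bar>\<epsilon> m\<bar> \<le> 1) \<Longrightarrow>
    \<exists>S. (\<lambda>k::nat. c k * (\<epsilon> (int k) * gauss (l / L) (real k - (v * L / l + 2 * real n)))) sums S \<and>
      \<bar>S - (\<Sum>\<^sub>\<infinity>m::int. \<epsilon> m * gauss (l / L) (real_of_int m - (v * L / l + 2 * real n)))\<bar> * sqrt (l / L)
        \<le> K * gauss (L / l) (3/2)"
proof -
  obtain T where T: "T > 0" "\<And>t x. 0 < t \<Longrightarrow> t \<le> 1 \<Longrightarrow> theta t x \<le> T / sqrt t"
    using theta_upper_bound by blast
  \<comment> \<open>Chosen so that \<open>exp (- (D * L)) = gauss (L / l) (3/2)\<close>.\<close>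
  define D where "D = 9 * pi / (4 * l)"
  have D: "D > 0" using l by (simp add: D_def)
  \<comment> \<open>The bound 2 V / l gives |v L / l| <= n / 2, hence x >= 3 n / 2. The bound D + 1
    gives q^n <= exp (- D L) exp (- L), where exp (- L) absorbs L^2. The last bound lets the
    Gaussian below n beat exp (B L^2).\<close>
  define M where "M = max (max 1 (2 * V / l)) (max (D + 1) (8 * (B + D) / (pi * l)))"
  have M: "M \<ge> 1" "M \<ge> 2 * V / l" "M \<ge> D + 1" "M \<ge> 8 * (B + D) / (pi * l)"
    by (auto simp: M_def)
  \<comment> \<open>The first summand comes from the indices k >= n, the second from those below
    n.\<close>
  define K where "K = 2 * B * exp (2 * B) * T + 2 * T"
  show ?thesis
  proof (rule that [of M K])
    fix L v :: real and n :: nat and c :: "nat \<Rightarrow> real" and \<epsilon> :: "int \<Rightarrow> real"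
    assume L: "L \<ge> 1" "L \<ge> l" and n: "real n \<ge> M * L\<^sup>2" and v: "\<bar>v\<bar> \<le> V"
      and c: "\<And>k. exp (- (B * L\<^sup>2 * exp (- (pi / L)) ^ k)) \<le> c k"
         "\<And>k. c k \<le> exp (B * L\<^sup>2 * exp (- (pi / L)) ^ k)"
      and \<epsilon>: "\<And>m. \<bar>\<epsilon> m\<bar> \<le> 1"
    define t where "t = l / L"
    define q where "q = exp (- (pi / L))"
    define x where "x = v * L / l + 2 * real n"
    have t: "0 < t" "t \<le> 1" using l L by (auto simp: t_def)
    have q: "0 < q" "q < 1" using L by (auto simp: q_def)
    have L2: "L \<le> L\<^sup>2" using L by (simp add: power2_eq_square)
    have "\<bar>v * L / l\<bar> \<le> V * L / l"
      using v L l by (simp add: abs_mult divide_right_mono mult_right_mono)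
    also have "\<dots> = 2 * V / l * L / 2" by simp
    also have "\<dots> \<le> M * L\<^sup>2 / 2"
      using M L L2 by (intro divide_right_mono mult_mono) auto
    also have "\<dots> \<le> real n / 2" using n by simp
    finally have "- (v * L / l) \<le> real n / 2" by (rule abs_le_D2)
    then have xn: "real n + real n / 2 \<le> x" unfolding x_def by simp
    have G: "gauss (L / l) (3/2) = exp (- (D * L))"
      by (simp add: gauss_def D_def power2_eq_square)
    obtain S where S: "(\<lambda>k. c k * (\<epsilon> (int k) * gauss t (real k - x))) sums S"
      and err: "\<bar>S - (\<Sum>\<^sub>\<infinity>m::int. \<epsilon> m * gauss t (real_of_int m - x))\<bar> \<le>
           B * L\<^sup>2 * q ^ n * exp (B * L\<^sup>2 * q ^ n) * theta t x +
           exp (B * L\<^sup>2) * gauss (t / 2) (real n / 2) * theta (t / 2) x"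
      using theta_perturbation [of t q "B * L\<^sup>2" c \<epsilon> "real n / 2" n x] t q B c \<epsilon> xn
      unfolding q_def by auto
    have th: "theta t x * sqrt t \<le> T" "theta (t / 2) x * sqrt t \<le> 2 * T"
    proof -
      show "theta t x * sqrt t \<le> T"
        using T(2) [OF t, of x] t by (simp add: field_simps)
      have "theta (t / 2) x * sqrt t = theta (t / 2) x * sqrt (t / 2) * sqrt 2"
        by (simp add: real_sqrt_divide)
      also have "\<dots> \<le> T * 2"
        using T(2) [of "t / 2" x] t T(1) by (intro mult_mono) (auto simp: field_simps real_le_lsqrt)
      finally show "theta (t / 2) x * sqrt t \<le> 2 * T" by simp
    qed
    have "q ^ n = exp (- (pi * real n / L))"
      by (simp add: q_def flip: exp_of_nat_mult)
    also have "\<dots> \<le> exp (- ((D + 1) * L))"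
    proof -
      have "(D + 1) * L \<le> M * L" using M L by (intro mult_right_mono) auto
      also have "\<dots> = M * L\<^sup>2 / L" using L by (simp add: power2_eq_square)
      also have "\<dots> \<le> real n / L" using n L by (intro divide_right_mono) auto
      also have "\<dots> \<le> pi * real n / L"
        using pi_ge_two L by (intro divide_right_mono) (auto simp: mult_le_cancel_right1)
      finally show ?thesis by simp
    qed
    also have "\<dots> = exp (- (D * L)) * exp (- L)"
      by (simp add: algebra_simps flip: exp_add)
    finally have qn: "q ^ n \<le> exp (- (D * L)) * exp (- L)" .
    have "L\<^sup>2 * exp (- L) \<le> 2"
    proof -
      have "1 + L + L\<^sup>2 / 2 \<le> exp L"
        using exp_lower_Taylor_quadratic [of L] L by simp
      then have "L\<^sup>2 \<le> 2 * exp L" using L by linarith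
      then show ?thesis by (simp add: exp_minus field_simps)
    qed
    then have *: "exp (- (D * L)) * (L\<^sup>2 * exp (- L)) \<le> exp (- (D * L)) * 2"
      by (rule mult_left_mono) simp
    have "L\<^sup>2 * q ^ n \<le> L\<^sup>2 * (exp (- (D * L)) * exp (- L))"
      using qn by (rule mult_left_mono) simp
    also have "\<dots> = exp (- (D * L)) * (L\<^sup>2 * exp (- L))"
      by (simp only: mult_ac)
    also note *
    finally have qn2: "L\<^sup>2 * q ^ n \<le> 2 * exp (- (D * L))"
      by (simp only: mult.commute)
    also have "\<dots> \<le> 2" using D L by simp
    finally have "L\<^sup>2 * q ^ n \<le> 2" .
    then have "exp (B * L\<^sup>2 * q ^ n) \<le> exp (2 * B)"
      using mult_left_mono [of "L\<^sup>2 * q ^ n" 2 B] B by (simp add: mult_ac)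
    moreover have "B * L\<^sup>2 * q ^ n \<le> 2 * B * exp (- (D * L))"
      using mult_left_mono [OF qn2 B] by (simp only: mult_ac)
    ultimately have f1: "B * L\<^sup>2 * q ^ n * exp (B * L\<^sup>2 * q ^ n) * (theta t x * sqrt t) \<le>
        2 * B * exp (- (D * L)) * exp (2 * B) * T"
      using th(1) B q t by (rule_tac mult_mono [OF mult_mono]) auto
    \<comment> \<open>The Gaussian here is exp (- pi t n^2 / 8). With t = l / L and n >= M L^2, its
      exponent is of order L^3 and exceeds (B + D) L^2 by the choice of M.\<close>
    have f2: "exp (B * L\<^sup>2) * gauss (t / 2) (real n / 2) * (theta (t / 2) x * sqrt t) \<le>
        exp (- (D * L)) * (2 * T)"
    proof -
      have "8 * (B + D) \<le> pi * l * M"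
        using M(4) l by (simp add: field_simps)
      also have "\<dots> \<le> pi * l * (M\<^sup>2 * L)"
        using M(1) L(1) l mult_mono [of 1 M 1 L]
        by (intro mult_left_mono) (auto simp: power2_eq_square mult.assoc)
      finally have "(B + D) * L\<^sup>2 \<le> pi * l * (M\<^sup>2 * L) / 8 * L\<^sup>2"
        by (intro mult_right_mono) auto
      also have "\<dots> = pi * t / 8 * (M * L\<^sup>2)\<^sup>2"
        using L by (simp add: t_def power2_eq_square)
      also have "\<dots> \<le> pi * t / 8 * (real n)\<^sup>2"
        using n M L t by (intro mult_left_mono power_mono) auto
      finally have "B * L\<^sup>2 + D * L\<^sup>2 \<le> pi * t / 8 * (real n)\<^sup>2"
        by (simp add: algebra_simps)
      moreover have "D * L \<le> D * L\<^sup>2"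
        using D L2 by (intro mult_left_mono) auto
      ultimately have "B * L\<^sup>2 - pi * t / 8 * (real n)\<^sup>2 \<le> - (D * L)"
        by linarith
      then have "exp (B * L\<^sup>2) * gauss (t / 2) (real n / 2) \<le> exp (- (D * L))"
        by (simp add: gauss_def power_divide flip: exp_add)
      then show ?thesis
        using th(2) t by (rule_tac mult_mono) auto
    qed
    have "\<bar>S - (\<Sum>\<^sub>\<infinity>m::int. \<epsilon> m * gauss t (real_of_int m - x))\<bar> * sqrt t \<le>
        B * L\<^sup>2 * q ^ n * exp (B * L\<^sup>2 * q ^ n) * (theta t x * sqrt t) +
        exp (B * L\<^sup>2) * gauss (t / 2) (real n / 2) * (theta (t / 2) x * sqrt t)"
      using mult_right_mono [OF err, of "sqrt t"] t by (simp add: distrib_right mult.assoc)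
    also note add_mono [OF f1 f2]
    also have "2 * B * exp (- (D * L)) * exp (2 * B) * T + exp (- (D * L)) * (2 * T) = K * gauss (L / l) (3/2)"
      by (simp add: G K_def algebra_simps)
    finally have "\<bar>S - (\<Sum>\<^sub>\<infinity>m::int. \<epsilon> m * gauss t (real_of_int m - x))\<bar> * sqrt t
        \<le> K * gauss (L / l) (3/2)" .
    with S show "\<exists>S. (\<lambda>k::nat. c k * (\<epsilon> (int k) * gauss (l / L) (real k - (v * L / l + 2 * real n)))) sums S \<and>
      \<bar>S - (\<Sum>\<^sub>\<infinity>m::int. \<epsilon> m * gauss (l / L) (real_of_int m - (v * L / l + 2 * real n)))\<bar> * sqrt (l / L)
        \<le> K * gauss (L / l) (3/2)"
      unfolding t_def x_def by blast
  qed
qed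

subsection \<open>The series $g$ at the scaled arguments\<close>

lemma admissible_scale_eventually:
  assumes "admissible_scale lam"
  shows "\<forall>\<^sub>F n in sequentially. lam n \<ge> C" and "\<forall>\<^sub>F n in sequentially. real n \<ge> M * (lam n)\<^sup>2"
proof -
  have ln: "\<forall>\<^sub>F n in sequentially. lam n / ln (real n) \<ge> max C 0"
    and sq: "\<forall>\<^sub>F n in sequentially. real n / (lam n)\<^sup>2 \<ge> M"
    and pos: "\<And>n. n \<ge> 1 \<Longrightarrow> lam n > 0"
    using assms unfolding admissible_scale_def filterlim_at_top by blast+
  show "\<forall>\<^sub>F n in sequentially. lam n \<ge> C"
    \<comment> \<open>From n >= 3 > e comes ln n >= 1; \<open>max C 0\<close> ensures that the
      quotient is nonnegative when multiplied by ln n.\<close>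
    using ln eventually_ge_at_top [of 3]
  proof eventually_elim
    case (elim n)
    have "exp 1 \<le> real n"
      using exp_le elim by (simp add: order_trans [of _ 3])
    then have "1 \<le> ln (real n)"
      using elim by (simp add: ln_ge_iff)
    then have "max C 0 * 1 \<le> lam n / ln (real n) * ln (real n)"
      using elim by (intro mult_mono) auto
    then show ?case
      using \<open>1 \<le> ln (real n)\<close> by simp
  qed
  show "\<forall>\<^sub>F n in sequentially. real n \<ge> M * (lam n)\<^sup>2"
    using sq eventually_ge_at_top [of 1]
  proof eventually_elim
    case (elim n)
    then show ?case
      using pos [of n] by (simp add: field_simps)
  qed
qed

text \<open>All Pochhammer products lie between exp (- const L^2 q^k) and 1. Those in the
  denominator turn the lower bound into an upper bound above 1, hence the two-sided form.\<close>

lemma g_series_coefficients: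
  fixes r s :: nat and \<alpha> \<beta> :: "nat \<Rightarrow> real"
  assumes \<alpha>: "\<forall>j\<in>{1..r}. \<alpha> j > 0" and \<beta>: "\<forall>k\<in>{1..s}. \<beta> k > 0"
  obtains B where "B \<ge> 0" and
    "\<And>L q. L \<ge> 1 \<Longrightarrow> q = exp (- (pi / L)) \<Longrightarrow> \<exists>c::nat \<Rightarrow> real.
       (\<forall>k. exp (- (B * L\<^sup>2 * q ^ k)) \<le> c k \<and> c k \<le> exp (B * L\<^sup>2 * q ^ k) \<and>
        of_real (c k) = qpoch_inf (of_real (q ^ (k + 1))) q *
           (\<Prod>j=1..s. qpoch_inf (of_real (q powr \<beta> j * q ^ k)) q) /
           (\<Prod>j=1..r. qpoch_inf (of_real (q powr \<alpha> j * q ^ k)) q))"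
proof -
  define b where "b = (\<lambda>\<gamma>. (1 + 1 / pi) * (1 + 1 / (pi * \<gamma>)))"
  define B1 B2 B3 where "B1 = b 1" and "B2 = (\<Sum>j=1..s. b (\<beta> j))" and "B3 = (\<Sum>j=1..r. b (\<alpha> j))"
  have "b \<gamma> \<ge> 0" if "\<gamma> > 0" for \<gamma>
    using that by (simp add: b_def)
  then have B: "B1 \<ge> 0" "B2 \<ge> 0" "B3 \<ge> 0"
    using \<alpha> \<beta> by (auto simp: B1_def B2_def B3_def intro!: sum_nonneg)
  show ?thesis
  proof
    show "B1 + B2 + B3 \<ge> 0" using B by simp
    fix L q :: real assume L: "L \<ge> 1" and q: "q = exp (- (pi / L))"
    have q0: "q > 0" by (simp add: q)
    have "\<exists>c. exp (- ((B1 + B2 + B3) * L\<^sup>2 * q ^ k)) \<le> c \<and> c \<le> exp ((B1 + B2 + B3) * L\<^sup>2 * q ^ k) \<and>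
        of_real c = qpoch_inf (of_real (q ^ (k + 1))) q *
           (\<Prod>j=1..s. qpoch_inf (of_real (q powr \<beta> j * q ^ k)) q) /
           (\<Prod>j=1..r. qpoch_inf (of_real (q powr \<alpha> j * q ^ k)) q)" for k
    proof -
      define u where "u = L\<^sup>2 * q ^ k"
      have u: "u \<ge> 0" using q0 by (simp add: u_def)
      \<comment> \<open>The factor at \<open>q ^ (k + 1)\<close> is the case \<gamma> = 1.\<close>
      obtain Q1 where Q1: "qpoch_inf (of_real (q powr 1 * q ^ k)) q = of_real Q1"
          "exp (- (B1 * u)) \<le> Q1" "Q1 \<le> 1"
        using qpoch_inf_scale_bounds [of 1 L q k] L q unfolding B1_def b_def u_def mult.assoc
        by (metis zero_less_one)
      obtain Q2 where Q2: "(\<Prod>j=1..s. qpoch_inf (of_real (q powr \<beta> j * q ^ k)) q) = of_real Q2"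
          "exp (- (B2 * u)) \<le> Q2" "Q2 \<le> 1"
        using qpoch_inf_prod_bounds [of "{1..s}" \<beta> L q k] \<beta> L q unfolding B2_def b_def u_def mult.assoc
        by metis
      obtain Q3 where Q3: "(\<Prod>j=1..r. qpoch_inf (of_real (q powr \<alpha> j * q ^ k)) q) = of_real Q3"
          "exp (- (B3 * u)) \<le> Q3" "Q3 \<le> 1"
        using qpoch_inf_prod_bounds [of "{1..r}" \<alpha> L q k] \<alpha> L q unfolding B3_def b_def u_def mult.assoc
        by metis
      have pos: "Q1 > 0" "Q2 > 0" "Q3 > 0"
        using Q1(2) Q2(2) Q3(2) exp_gt_zero less_le_trans by blast+
      have "exp (- ((B1 + B2 + B3) * u)) \<le> exp (- (B1 * u)) * exp (- (B2 * u))"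
        using B u by (simp add: algebra_simps flip: exp_add)
      also have "\<dots> \<le> Q1 * Q2"
        using Q1 Q2 pos by (intro mult_mono) auto
      also have "\<dots> \<le> Q1 * Q2 / Q3"
        using Q3 pos by (simp add: field_simps)
      finally have lower: "exp (- ((B1 + B2 + B3) * u)) \<le> Q1 * Q2 / Q3" .
      have "Q1 * Q2 \<le> 1"
        using Q1 Q2 pos by (simp add: mult_le_one)
      then have "Q1 * Q2 / Q3 \<le> 1 / exp (- (B3 * u))"
        using Q3 pos by (intro frac_le) auto
      also have "\<dots> = exp (B3 * u)"
        by (simp add: exp_minus divide_inverse)
      also have "\<dots> \<le> exp ((B1 + B2 + B3) * u)"
        using B u by (simp add: mult_right_mono)
      finally have upper: "Q1 * Q2 / Q3 \<le> exp ((B1 + B2 + B3) * u)" .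
      have "qpoch_inf (of_real (q ^ (k + 1))) q = of_real Q1"
        using Q1(1) q0 by simp
      with Q2(1) Q3(1) have "of_real (Q1 * Q2 / Q3) = qpoch_inf (of_real (q ^ (k + 1))) q *
           (\<Prod>j=1..s. qpoch_inf (of_real (q powr \<beta> j * q ^ k)) q) /
           (\<Prod>j=1..r. qpoch_inf (of_real (q powr \<alpha> j * q ^ k)) q)"
        by (simp only: of_real_mult of_real_divide)
      with lower upper show ?thesis
        unfolding u_def mult.assoc by blast
    qed
    then show "\<exists>c::nat \<Rightarrow> real.
       (\<forall>k. exp (- ((B1 + B2 + B3) * L\<^sup>2 * q ^ k)) \<le> c k \<and> c k \<le> exp ((B1 + B2 + B3) * L\<^sup>2 * q ^ k) \<and>
        of_real (c k) = qpoch_inf (of_real (q ^ (k + 1))) q *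
           (\<Prod>j=1..s. qpoch_inf (of_real (q powr \<beta> j * q ^ k)) q) /
           (\<Prod>j=1..r. qpoch_inf (of_real (q powr \<alpha> j * q ^ k)) q))"
      by (rule choice_iff [THEN iffD1, OF allI])
  qed
qed

text \<open>The exponent is quadratic in k with its maximum at x = v L / l + 2 n. The maximal value
  pi (l / L) x^2, rewritten in terms of v, is the exponent of the claimed prefactor.\<close>

lemma complete_the_square:
  assumes l: "l > 0" and L: "L > 0" and q: "q = exp (- (pi / L))"
  shows "q powr (l * real (k\<^sup>2)) * (q powr (- (4 * real n * l)) * exp (2 * pi * v)) ^ k =
           exp (pi * L / l * (v + 2 * real n * l / L)\<^sup>2) *
           gauss (l / L) (real k - (v * L / l + 2 * real n))"
proof -
  have "q powr (- (4 * real n * l)) * exp (2 * pi * v) = exp (4 * real n * l * (pi / L) + 2 * pi * v)"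
    by (simp add: q powr_def exp_add)
  moreover have "q powr (l * real (k\<^sup>2)) = exp (- (l * real (k\<^sup>2) * (pi / L)))"
    by (simp add: q powr_def)
  ultimately have "q powr (l * real (k\<^sup>2)) * (q powr (- (4 * real n * l)) * exp (2 * pi * v)) ^ k =
      exp (- (l * real (k\<^sup>2) * (pi / L)) + real k * (4 * real n * l * (pi / L) + 2 * pi * v))"
    by (simp only: exp_of_nat_mult [symmetric] exp_add [symmetric])
  also have "- (l * real (k\<^sup>2) * (pi / L)) + real k * (4 * real n * l * (pi / L) + 2 * pi * v) =
      pi * L / l * (v + 2 * real n * l / L)\<^sup>2 +
      - (pi * (l / L) * (real k - (v * L / l + 2 * real n))\<^sup>2)"
    using l L by (simp add: power2_eq_square field_simps)
  finally show ?thesis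
    by (simp only: exp_add gauss_def)
qed

text \<open>The sign \<sigma> treats both formulas at once: \<sigma> = 1 is the argument with the
  minus sign, where (-w)^k is positive, and \<sigma> = -1 produces the alternating series.\<close>

lemma g_series_eq_gauss_sum:
  fixes c :: "nat \<Rightarrow> real" and \<sigma> :: real
  assumes l: "l > 0" and L: "L > 0" and q: "q = exp (- (pi / L))"
    and c: "\<And>k. of_real (c k) = qpoch_inf (of_real (q ^ (k + 1))) q *
           (\<Prod>j=1..s. qpoch_inf (of_real (b j * q ^ k)) q) /
           (\<Prod>j=1..r. qpoch_inf (of_real (a j * q ^ k)) q)"
    and S: "(\<lambda>k. c k * (\<sigma> ^ k * gauss (l / L) (real k - (v * L / l + 2 * real n)))) sums S"
    and w: "w = - (\<sigma> * (q powr (- (4 * real n * l)) * exp (2 * pi * v)))"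
  shows "g_series r s a b q l (of_real w) =
           of_real (exp (pi * L / l * (v + 2 * real n * l / L)\<^sup>2) * S)"
proof -
  let ?M = "exp (pi * L / l * (v + 2 * real n * l / L)\<^sup>2)"
  let ?g = "\<lambda>k. gauss (l / L) (real k - (v * L / l + 2 * real n))"
  have "qpoch_inf (of_real (q ^ (k + 1))) q * (\<Prod>j=1..s. qpoch_inf (of_real (b j * q ^ k)) q) *
      of_real (q powr (l * real (k\<^sup>2))) * (- of_real w) ^ k /
      (\<Prod>j=1..r. qpoch_inf (of_real (a j * q ^ k)) q) = of_real (?M * (c k * (\<sigma> ^ k * ?g k)))" for k
  proof -
    have "q powr (l * real (k\<^sup>2)) * (- w) ^ k = \<sigma> ^ k * (?M * ?g k)"
      unfolding complete_the_square [OF l L q, symmetric] w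
      by (simp add: power_mult_distrib)
    then have "complex_of_real (q powr (l * real (k\<^sup>2))) * (- of_real w) ^ k = of_real (\<sigma> ^ k * (?M * ?g k))"
      by (metis of_real_minus of_real_mult of_real_power)
    then show ?thesis
      using c [of k] by (simp add: mult_ac)
  qed
  moreover have "(\<lambda>k. complex_of_real (?M * (c k * (\<sigma> ^ k * ?g k)))) sums of_real (?M * S)"
    by (intro sums_of_real sums_mult S)
  ultimately show ?thesis
    unfolding g_series_def by (simp add: sums_iff)
qed

theorem theorem2:
  fixes lam :: "nat \<Rightarrow> real" and r s :: nat and l :: real
    and \<alpha> \<beta> :: "nat \<Rightarrow> real"
  assumes "admissible_scale lam"
    and "l > 0"
    and "\<forall>j\<in>{1..r}. \<alpha> j > 0"
    and "\<forall>k\<in>{1..s}. \<beta> k > 0"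
  shows "\<exists>E1 E2 :: nat \<Rightarrow> real \<Rightarrow> complex.
    bigo_unif_on_compacts E1 (\<lambda>n. exp (- (pi * lam n / l))) \<and>
    bigo_unif_on_compacts E2 (\<lambda>n. exp (- (2 * pi * lam n / l))) \<and>
    (\<forall>n\<ge>1. \<forall>v::real.
      let z = exp (2 * pi * v);
          q = exp (- (pi / lam n));
          g = (\<lambda>w::real. g_series r s (\<lambda>j. q powr \<alpha> j) (\<lambda>k. q powr \<beta> k) q l (of_real w))
      in
        g (- (q powr (- (4 * real n * l)) * z)) =
          of_real (exp (pi * lam n / l * (v + 2 * real n * l / lam n)\<^sup>2) * sqrt (lam n / l)) *
          (1 + E1 n v) \<and>
        g (q powr (- (4 * real n * l)) * z) =
          of_real (exp (pi * lam n / l * (v + 2 * real n * l / lam n)\<^sup>2 - pi * lam n / (4 * l)) *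
                   (2 * sqrt (lam n / l))) *
          (of_real (cos (pi * lam n * v / l)) + E2 n v))"
proof -
  note l = \<open>l > 0\<close>
  define g where "g = (\<lambda>n (w::real). g_series r s (\<lambda>j. exp (- (pi / lam n)) powr \<alpha> j)
      (\<lambda>k. exp (- (pi / lam n)) powr \<beta> k) (exp (- (pi / lam n))) l (of_real w))"
  define w where "w = (\<lambda>n v. exp (- (pi / lam n)) powr (- (4 * real n * l)) * exp (2 * pi * v))"
  define P where "P = (\<lambda>n v. exp (pi * lam n / l * (v + 2 * real n * l / lam n)\<^sup>2))"
  define R where "R = (\<lambda>n. sqrt (lam n / l))"
  define H where "H = (\<lambda>n. exp (- (pi * lam n / (4 * l))))"
  \<comment> \<open>E1 and E2 are obtained by solving the two claimed identities for the error, so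
    the identities hold by construction wherever the prefactors are nonzero. The content lies in the
    bounds.\<close>
  define E1 where "E1 = (\<lambda>n v. g n (- w n v) / of_real (P n v * R n) - 1)"
  define E2 where "E2 = (\<lambda>n v. g n (w n v) / of_real (P n v * H n * (2 * R n)) - of_real (cos (pi * lam n * v / l)))"
  have pos: "lam n > 0" if "n \<ge> 1" for n
    using assms(1) that by (simp add: admissible_scale_def)
  obtain B where B: "B \<ge> 0" and coeff: "\<And>L q. L \<ge> 1 \<Longrightarrow> q = exp (- (pi / L)) \<Longrightarrow> \<exists>c::nat \<Rightarrow> real.
       (\<forall>k. exp (- (B * L\<^sup>2 * q ^ k)) \<le> c k \<and> c k \<le> exp (B * L\<^sup>2 * q ^ k) \<and>
        of_real (c k) = qpoch_inf (of_real (q ^ (k + 1))) q *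
           (\<Prod>j=1..s. qpoch_inf (of_real (q powr \<beta> j * q ^ k)) q) /
           (\<Prod>j=1..r. qpoch_inf (of_real (q powr \<alpha> j * q ^ k)) q))"
    using g_series_coefficients [OF assms(3,4)] by blast
  obtain K1 where K1: "K1 > 0"
    "\<And>t x. 0 < t \<Longrightarrow> t \<le> 1 \<Longrightarrow> \<bar>theta t x * sqrt t - 1\<bar> \<le> K1 * gauss (1/t) 1"
    using theta_asymptotics by blast
  obtain K2 where K2: "K2 > 0"
    "\<And>t x. 0 < t \<Longrightarrow> t \<le> 1 \<Longrightarrow>
       \<bar>alt_theta t x * sqrt t - 2 * gauss (1/t) (1/2) * cos (pi * x)\<bar> \<le> K2 * gauss (1/t) (3/2)"
    using alt_theta_asymptotics by blast
  have main: "\<exists>C N. \<forall>n\<ge>N. \<forall>v\<in>X. norm (E1 n v) \<le> C * exp (- (pi * lam n / l)) \<and>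
      norm (E2 n v) \<le> C * exp (- (2 * pi * lam n / l))" if X: "compact X" for X
  proof -
    obtain V where V: "\<And>v. v \<in> X \<Longrightarrow> \<bar>v\<bar> \<le> V"
      using compact_imp_bounded [OF X] by (auto simp: bounded_iff)
    show ?thesis
    proof (rule scaled_perturbation_bound [OF l B, where V = V], goal_cases)
      case (1 K M)
      have "\<forall>\<^sub>F n in sequentially. lam n \<ge> max 1 l \<and> real n \<ge> M * (lam n)\<^sup>2"
        by (intro eventually_conj admissible_scale_eventually assms(1))
      then obtain N where N: "\<And>n. n \<ge> N \<Longrightarrow> lam n \<ge> max 1 l \<and> real n \<ge> M * (lam n)\<^sup>2"
        by (auto simp: eventually_sequentially)
      \<comment> \<open>The sign of K is not known, hence |K|; one constant is taken for both
        errors.\<close>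
      have "norm (E1 n v) \<le> (\<bar>K\<bar> + K1 + K2) * exp (- (pi * lam n / l)) \<and>
        norm (E2 n v) \<le> (\<bar>K\<bar> + K1 + K2) * exp (- (2 * pi * lam n / l))" if n: "n \<ge> N" and v: "v \<in> X" for n v
      proof -
        define L where "L = lam n"
        define t where "t = l / L"
        define q where "q = exp (- (pi / L))"
        define x where "x = v * L / l + 2 * real n"
        have L: "L \<ge> 1" "L \<ge> l" "real n \<ge> M * L\<^sup>2"
          using N [OF n] by (auto simp: L_def)
        have t: "0 < t" "t \<le> 1" "1 / t = L / l"
          using L l by (auto simp: t_def)
        have R: "R n = 1 / sqrt t" "R n > 0"
          using t L l by (auto simp: R_def t_def L_def real_sqrt_divide)
        obtain c where c: "\<And>k. exp (- (B * L\<^sup>2 * q ^ k)) \<le> c k" "\<And>k. c k \<le> exp (B * L\<^sup>2 * q ^ k)"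
          "\<And>k. of_real (c k) = qpoch_inf (of_real (q ^ (k + 1))) q *
             (\<Prod>j=1..s. qpoch_inf (of_real (q powr \<beta> j * q ^ k)) q) /
             (\<Prod>j=1..r. qpoch_inf (of_real (q powr \<alpha> j * q ^ k)) q)"
          using coeff [OF L(1) q_def] by blast
        \<comment> \<open>The same coefficients c enter twice, with constant signs for E1 and with
          parity signs for E2.\<close>
        note KM = 1 [OF L V [OF v], of c, folded q_def t_def x_def, OF c(1,2)]
        obtain S1 where S1: "(\<lambda>k. c k * gauss t (real k - x)) sums S1"
          "\<bar>S1 - (\<Sum>\<^sub>\<infinity>m::int. gauss t (real_of_int m - x))\<bar> * sqrt t \<le> K * gauss (L / l) (3/2)"
          using KM [of "\<lambda>_. 1"] by auto
        have sgn_le: "\<bar>if even m then 1 else - 1 :: real\<bar> \<le> 1" for m :: int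
          by simp
        obtain S2 where S2: "(\<lambda>k. c k * ((if even k then 1 else - 1) * gauss t (real k - x))) sums S2"
          "\<bar>S2 - (\<Sum>\<^sub>\<infinity>m::int. (if even m then 1 else - 1) * gauss t (real_of_int m - x))\<bar> * sqrt t
             \<le> K * gauss (L / l) (3/2)"
          using KM [of "\<lambda>m. if even m then 1 else - 1", OF sgn_le] by auto
        have th: "(\<Sum>\<^sub>\<infinity>m::int. gauss t (real_of_int m - x)) = theta t (- x)"
          "(\<Sum>\<^sub>\<infinity>m::int. (if even m then 1 else - 1) * gauss t (real_of_int m - x)) = alt_theta t (- x)"
          by (simp_all add: theta_def alt_theta_def)
        have "g n (- w n v) = of_real (P n v * S1)"
          unfolding g_def w_def P_def L_def [symmetric] q_def [symmetric]
          by (rule g_series_eq_gauss_sum [OF l _ q_def c(3), where \<sigma> = 1])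
             (use S1 L in \<open>auto simp: t_def x_def\<close>)
        then have "E1 n v = of_real (S1 * sqrt t - 1)"
          using R by (simp add: E1_def P_def)
        then have "norm (E1 n v) = \<bar>S1 * sqrt t - 1\<bar>"
          by (metis norm_of_real)
        also have "\<dots> = \<bar>(S1 - theta t (- x)) * sqrt t + (theta t (- x) * sqrt t - 1)\<bar>"
          by (simp add: algebra_simps)
        also have "\<dots> \<le> \<bar>S1 - theta t (- x)\<bar> * sqrt t + \<bar>theta t (- x) * sqrt t - 1\<bar>"
          using abs_triangle_ineq [of "(S1 - theta t (- x)) * sqrt t"] t by (simp add: abs_mult)
        also have "\<dots> \<le> K * gauss (L / l) (3/2) + K1 * gauss (L / l) 1"
          using S1(2) K1(2) [OF t(1,2), of "- x"] unfolding th t(3) by simp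
        \<comment> \<open>The perturbation error is smaller than the theta error
          \<open>gauss (L / l) 1\<close>, which is exactly exp (- pi L / l).\<close>
        also have "\<dots> \<le> \<bar>K\<bar> * gauss (L / l) 1 + (K1 + K2) * gauss (L / l) 1"
        proof -
          have "pi * (L / l) * 1\<^sup>2 \<le> pi * (L / l) * (3/2)\<^sup>2"
            using L l by (intro mult_left_mono power_mono) auto
          then have "gauss (L / l) (3/2) \<le> gauss (L / l) 1"
            unfolding gauss_def by simp
          then show ?thesis
            using K1(1) K2(1) by (intro add_mono mult_mono) auto
        qed
        finally have E1: "norm (E1 n v) \<le> (\<bar>K\<bar> + K1 + K2) * exp (- (pi * lam n / l))"
          by (simp add: gauss_def L_def algebra_simps)
        \<comment> \<open>The centre x contains the even integer 2 n, so the cosine depends only on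
          v L / l.\<close>
        have "cos (pi * (- x)) = cos (pi * L * v / l + 2 * pi * real_of_int (int n))"
          unfolding mult_minus_right cos_minus by (simp add: x_def algebra_simps)
        then have cosx: "cos (pi * (- x)) = cos (pi * L * v / l)"
          by (simp only: cos_add_2pi_int)
        have H: "gauss (L / l) (1/2) = H n" "H n > 0"
          by (simp_all add: gauss_def H_def L_def power2_eq_square mult_ac)
        have sgn: "(- 1) ^ k = (if even k then 1 else - 1 :: real)" for k :: nat
          by simp
        have "g n (w n v) = of_real (P n v * S2)"
          unfolding g_def w_def P_def L_def [symmetric] q_def [symmetric]
          by (rule g_series_eq_gauss_sum [OF l _ q_def c(3), where \<sigma> = "- 1"])
             (use S2 L in \<open>auto simp: t_def x_def sgn\<close>)
        then have "E2 n v = of_real ((S2 * sqrt t - 2 * H n * cos (pi * L * v / l)) / (2 * H n))"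
          using R H by (simp add: E2_def P_def L_def diff_divide_distrib)
        then have "norm (E2 n v) = \<bar>S2 * sqrt t - 2 * H n * cos (pi * L * v / l)\<bar> / (2 * H n)"
          using H by (metis abs_divide abs_of_pos mult_pos_pos norm_of_real zero_less_numeral)
        also have "S2 * sqrt t - 2 * H n * cos (pi * L * v / l) = 
            (S2 - alt_theta t (- x)) * sqrt t + (alt_theta t (- x) * sqrt t - 2 * H n * cos (pi * L * v / l))"
          by (simp add: algebra_simps)
        also have "\<bar>\<dots>\<bar> \<le> \<bar>S2 - alt_theta t (- x)\<bar> * sqrt t + \<bar>alt_theta t (- x) * sqrt t - 2 * H n * cos (pi * L * v / l)\<bar>"
          using abs_triangle_ineq [of "(S2 - alt_theta t (- x)) * sqrt t"] t by (simp add: abs_mult)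
        also have "\<dots> \<le> K * gauss (L / l) (3/2) + K2 * gauss (L / l) (3/2)"
          using S2(2) K2(2) [OF t(1,2), of "- x"] unfolding th t(3) cosx H by (rule add_mono)
        also have "\<dots> \<le> (\<bar>K\<bar> + K1 + K2) * (2 * gauss (L / l) (3/2))"
        proof -
          have "(K + K2) * gauss (L / l) (3/2) \<le> (\<bar>K\<bar> + K1 + K2) * (2 * gauss (L / l) (3/2))"
            using K1 K2 by (intro mult_mono) auto
          then show ?thesis by (simp add: algebra_simps)
        qed
        \<comment> \<open>In units of pi L / l the exponents satisfy 9/4 = 2 + 1/4. Dividing by the
          amplitude 2 \<open>H n\<close> therefore leaves the relative error exp (- 2 pi L /
          l).\<close>
        also have "gauss (L / l) (3/2) = exp (- (2 * pi * lam n / l)) * H n"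
          using l by (simp add: gauss_def H_def L_def power2_eq_square flip: exp_add)
        finally have "norm (E2 n v) \<le> (\<bar>K\<bar> + K1 + K2) * exp (- (2 * pi * lam n / l))"
          using H by (simp add: divide_right_mono mult_ac)
        with E1 show ?thesis by blast
      qed
      then show ?case by blast
    qed
  qed
  show ?thesis
  proof (intro exI conjI allI impI)
    show "bigo_unif_on_compacts E1 (\<lambda>n. exp (- (pi * lam n / l)))"
      "bigo_unif_on_compacts E2 (\<lambda>n. exp (- (2 * pi * lam n / l)))"
      unfolding bigo_unif_on_compacts_def using main by meson+
    fix n :: nat and v :: real assume "n \<ge> 1"
    have nz: "P n v \<noteq> 0" "R n \<noteq> 0" "H n \<noteq> 0"
      using pos [OF \<open>n \<ge> 1\<close>] l by (simp_all add: P_def R_def H_def)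
    have PH: "P n v * H n = exp (pi * lam n / l * (v + 2 * real n * l / lam n)\<^sup>2 - pi * lam n / (4 * l))"
      by (simp add: P_def H_def flip: exp_add)
    have eq1: "g n (- w n v) = of_real (P n v * R n) * (1 + E1 n v)"
      using nz by (simp add: E1_def)
    have "g n (w n v) = of_real (P n v * H n * (2 * R n)) * (of_real (cos (pi * lam n * v / l)) + E2 n v)"
      using nz by (simp add: E2_def)
    note eq2 = this [unfolded PH]
    show "let z = exp (2 * pi * v);
          q = exp (- (pi / lam n));
          g = (\<lambda>w::real. g_series r s (\<lambda>j. q powr \<alpha> j) (\<lambda>k. q powr \<beta> k) q l (of_real w))
      in
        g (- (q powr (- (4 * real n * l)) * z)) =
          of_real (exp (pi * lam n / l * (v + 2 * real n * l / lam n)\<^sup>2) * sqrt (lam n / l)) *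
          (1 + E1 n v) \<and>
        g (q powr (- (4 * real n * l)) * z) =
          of_real (exp (pi * lam n / l * (v + 2 * real n * l / lam n)\<^sup>2 - pi * lam n / (4 * l)) *
                   (2 * sqrt (lam n / l))) *
          (of_real (cos (pi * lam n * v / l)) + E2 n v)"
      using eq1 eq2 unfolding Let_def g_def w_def P_def R_def by (rule conjI)
  qed
qed

end
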